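(* Let $k \in \mathbb{N}$ be any constant. Then $\textsc{HD}_{4,4}$ does not reduce to $\textsc{HD}_k$: there is no constant $c$ such that $\mathsf{D}^{\textsc{HD}_k}(\textsc{HD}_{4,4}^n) \le c$ for all $n \in \mathbb{N}$. In other words, $\textsc{HD}_{4,4}$ admits no constant-cost deterministic oracle protocol with query access to $\textsc{HD}_k$.
   Context: For binary strings $u,v$ of equal length, $\mathrm{dist}(u,v)$ is their Hamming distance. For $t\in\mathbb{N}$, $\textsc{HD}_k^t\colon\{0,1\}^t\times\{0,1\}^t\to\{0,1\}$ is $\textsc{HD}_k^t(u,v)=1$ iff $\mathrm{dist}(u,v)=k$; $\textsc{HD}_k$ denotes the family $\{\textsc{HD}_k^t : t\in\mathbb{N}\}$. For $n\in\mathbb{N}$, $\textsc{HD}_{4,4}^n\colon\{0,1\}^{n\times n}\times\{0,1\}^{n\times n}\to\{0,1\}$ takes two $n\times n$ Boolean matrices $x,y$ with rows $x_i,y_i\in\{0,1\}^n$, and $\textsc{HD}_{4,4}^n(x,y)=1$ iff there are two distinct rows $i\neq j$ with $\mathrm{dist}(x_i,y_i)=\mathrm{dist}(x_j,y_j)=4$ and $x_\ell=y_\ell$ for all $\ell\notin\{i,j\}$. Oracle protocols: for a set $\mathcal{Q}$ of Boolean matrices, $\mathsf{QS}(\mathcal{Q})$ is its closure under row and column copying, row and column permutations, and row and column deletions (equivalently, all matrices of the form $(x,y)\mapsto Q(\phi(x),\psi(y))$ for $Q\in\mathcal{Q}$ and arbitrary maps $\phi,\psi$ into its row and column index sets). A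 deterministic protocol for $P\colon\mathcal{X}\times\mathcal{Y}\to\Lambda$ with oracle access to $\mathcal{Q}$ is a binary tree whose inner nodes $v$ are labeled by $\mathcal{X}\times\mathcal{Y}$ matrices $Q_v\in\mathsf{QS}(\mathcal{Q})$ and whose leaves are labeled by elements of $\Lambda$; on input $(x,y)$ one moves from the root to the left or right child of $v$ according to the bit $Q_v(x,y)$; the protocol computes $P$ if the reached leaf is labeled $P(x,y)$ for all inputs. Its cost is the maximum number of inner nodes on a root-to-leaf path, and $\mathsf{D}^{\mathcal{Q}}(P)$ is the minimum cost of such a protocol. A family of problems $\mathcal{P}$ reduces to $\mathcal{Q}$ if there is a constant $c$ with $\mathsf{D}^{\mathcal{Q}}(P)\le c$ for all $P\in\mathcal{P}$. *)

theory Defs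
  imports "HOL-Library.Extended_Nat"
begin

text \<open>A communication problem \<open>X \<times> Y \<rightarrow> \<Lambda>\<close> carries its row and column index
  sets explicitly; the values of \<open>entry\<close> outside \<open>X \<times> Y\<close> are irrelevant. A Boolean matrix is a
  problem with \<open>\<Lambda> = {0,1}\<close>.\<close>

datatype ('x, 'y, 'l) problem =
  Problem (row_index: "'x set") (col_index: "'y set") (entry: "'x \<Rightarrow> 'y \<Rightarrow> 'l")

type_synonym ('x, 'y) bool_matrix = "('x, 'y, bool) problem"

definition bitstrings :: "nat \<Rightarrow> bool list set" where
  "bitstrings t = {u. length u = t}"

definition hdist :: "bool list \<Rightarrow> bool list \<Rightarrow> nat" where
  "hdist u v = card {i. i < length u \<and> u ! i \<noteq> v ! i}"

definition HD :: "nat \<Rightarrow> nat \<Rightarrow> (bool list, bool list) bool_matrix" where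
  "HD k t = Problem (bitstrings t) (bitstrings t) (\<lambda>u v. hdist u v = k)"

definition HD_family :: "nat \<Rightarrow> (bool list, bool list) bool_matrix set" where
  "HD_family k = range (HD k)"

text \<open>An \<open>n \<times> n\<close> Boolean matrix is the list of its rows.\<close>

definition square_matrices :: "nat \<Rightarrow> bool list list set" where
  "square_matrices n = {x. length x = n \<and> set x \<subseteq> bitstrings n}"

definition HD44 :: "nat \<Rightarrow> (bool list list, bool list list) bool_matrix" where
  "HD44 n = Problem (square_matrices n) (square_matrices n)
     (\<lambda>x y. \<exists>i<n. \<exists>j<n. i \<noteq> j \<and> hdist (x ! i) (y ! i) = 4 \<and> hdist (x ! j) (y ! j) = 4 \<and>
        (\<forall>l<n. l \<notin> {i, j} \<longrightarrow> x ! l = y ! l))"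

definition HD44_family :: "(bool list list, bool list list) bool_matrix set" where
  "HD44_family = range HD44"

text \<open>The members of \<open>QS(\<Q>)\<close> that are indexed by \<open>X \<times> Y\<close>: closure under copying, permuting and
  deleting rows and columns amounts to reindexing along arbitrary maps \<open>\<phi>\<close>, \<open>\<psi>\<close>.\<close>

definition QS ::
  "('a, 'b) bool_matrix set \<Rightarrow> 'x set \<Rightarrow> 'y set \<Rightarrow> ('x \<Rightarrow> 'y \<Rightarrow> bool) set" where
  "QS \<Q> X Y = {M. \<exists>Q\<in>\<Q>. \<exists>\<phi> \<psi>. \<phi> ` X \<subseteq> row_index Q \<and> \<psi> ` Y \<subseteq> col_index Q \<and>
     (\<forall>x\<in>X. \<forall>y\<in>Y. M x y = entry Q (\<phi> x) (\<psi> y))}"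

datatype ('x, 'y, 'l) protocol =
  Leaf 'l
| Node "'x \<Rightarrow> 'y \<Rightarrow> bool" "('x, 'y, 'l) protocol" "('x, 'y, 'l) protocol"

fun queries :: "('x, 'y, 'l) protocol \<Rightarrow> ('x \<Rightarrow> 'y \<Rightarrow> bool) set" where
  "queries (Leaf a) = {}"
| "queries (Node M T0 T1) = insert M (queries T0 \<union> queries T1)"

text \<open>Bit \<open>0\<close> leads to the left child, bit \<open>1\<close> to the right child.\<close>

fun run :: "('x, 'y, 'l) protocol \<Rightarrow> 'x \<Rightarrow> 'y \<Rightarrow> 'l" where
  "run (Leaf a) x y = a"
| "run (Node M T0 T1) x y = (if M x y then run T1 x y else run T0 x y)"

fun cost :: "('x, 'y, 'l) protocol \<Rightarrow> nat" where
  "cost (Leaf a) = 0"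
| "cost (Node M T0 T1) = Suc (max (cost T0) (cost T1))"

definition oracle_protocol ::
  "('a, 'b) bool_matrix set \<Rightarrow> ('x, 'y, 'l) problem \<Rightarrow> ('x, 'y, 'l) protocol \<Rightarrow> bool" where
  "oracle_protocol \<Q> P T \<longleftrightarrow> queries T \<subseteq> QS \<Q> (row_index P) (col_index P)"

definition computes :: "('x, 'y, 'l) protocol \<Rightarrow> ('x, 'y, 'l) problem \<Rightarrow> bool" where
  "computes T P \<longleftrightarrow> (\<forall>x\<in>row_index P. \<forall>y\<in>col_index P. run T x y = entry P x y)"

text \<open>The value is \<open>\<infinity>\<close> if no protocol exists; otherwise the infimum is attained, since \<open>enat\<close> is
  well-ordered.\<close>

definition oracle_complexity ::
  "('a, 'b) bool_matrix set \<Rightarrow> ('x, 'y, 'l) problem \<Rightarrow> enat" where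
  "oracle_complexity \<Q> P = Inf {enat (cost T) | T. oracle_protocol \<Q> P T \<and> computes T P}"

definition reduces_to ::
  "('x, 'y, 'l) problem set \<Rightarrow> ('a, 'b) bool_matrix set \<Rightarrow> bool" where
  "reduces_to \<P> \<Q> \<longleftrightarrow> (\<exists>c::nat. \<forall>P\<in>\<P>. oracle_complexity \<Q> P \<le> enat c)"

end

theory Submission
  imports Defs "HOL-Library.Ramsey"
begin

text \<open>Fix boundedly many queries \<open>card (\<phi> x \<Delta> \<psi> y) = k\<close>, where \<open>x\<close> and \<open>y\<close> assign values to positions
  and every position belongs to a row. Ramsey's theorem makes the sizes of the relevant distances,
  capped at a bound depending on \<open>k\<close>, depend only on the set \<open>D\<close> of positions where \<open>x\<close> and \<open>y\<close> differ.
  If changing some position in \<open>D\<close> moves \<open>\<phi>\<close> by more than \<open>2 * k\<close>, or if \<open>\<phi> x\<close> and \<open>\<psi> x\<close>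
  are far apart, then the distance on \<open>D\<close> exceeds \<open>k\<close> and the query answers \<open>0\<close>. Otherwise, relative to a base point, \<open>\<phi> x\<close> and \<open>\<psi> y\<close> are sets of bounded size. Their elements are listed,
  and after a second use of Ramsey's theorem each element depends on a fixed set of positions. The
  distance is then a constant plus twice the number of common elements whose position set meets \<open>D\<close>,
  that is, a coverage function of bounded degree. By sunflowers and pigeonholes there are two
  rows \<open>i\<close>, \<open>j\<close> for which all these coverage functions agree on some \<open>D\<close> with two positions in each
  row and some \<open>D'\<close> with one position in row \<open>i\<close> and three in row \<open>j\<close>. The first pair has row
  distances \<open>(4, 4)\<close> and the second \<open>(2, 6)\<close>, and no query distinguishes them.\<close>

section \<open>A Ramsey theorem for products\<close>

definition box :: "nat \<Rightarrow> nat \<Rightarrow> (nat \<Rightarrow> nat) set" where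
  "box L M = {..<L} \<rightarrow>\<^sub>E {..<M}"

definition reparam :: "nat \<Rightarrow> (nat \<Rightarrow> nat \<Rightarrow> nat) \<Rightarrow> (nat \<Rightarrow> nat) \<Rightarrow> nat \<Rightarrow> nat" where
  "reparam L \<iota> x = (\<lambda>p\<in>{..<L}. \<iota> p (x p))"

text \<open>The order \<open>x p < y p\<close> is required at every position, also outside
  \<open>D\<close>. Once position \<open>p\<close> draws its values from the \<open>p\<close>-th of
  consecutive blocks, the pair becomes one increasing sequence of length \<open>2 * L\<close>, the
  object that Ramsey's theorem colours.\<close>

definition pattern_invariant ::
  "nat \<Rightarrow> nat \<Rightarrow> ((nat \<Rightarrow> nat) \<Rightarrow> (nat \<Rightarrow> nat) \<Rightarrow> bool) \<Rightarrow> bool" where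
  "pattern_invariant L M P \<longleftrightarrow> (\<forall>D\<subseteq>{..<L}. \<exists>t. \<forall>x\<in>box L M. \<forall>y\<in>box L M.
     (\<forall>p<L. x p < y p) \<longrightarrow> P x (override_on x y D) = t)"

lemma box_less: "x \<in> box L M \<Longrightarrow> p < L \<Longrightarrow> x p < M"
  by (auto simp: box_def)

lemma box_mono: "x \<in> box L M \<Longrightarrow> M \<le> M' \<Longrightarrow> x \<in> box L M'"
  by (auto simp: box_def PiE_iff intro: less_le_trans)

lemma override_on_box: "x \<in> box L M \<Longrightarrow> y \<in> box L M \<Longrightarrow> override_on x y D \<in> box L M"
  by (auto simp: box_def PiE_iff override_on_def extensional_def)

lemma reparam_override_on:
  "reparam L \<iota> (override_on x y D) = override_on (reparam L \<iota> x) (reparam L \<iota> y) D"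
  by (auto simp: reparam_def override_on_def fun_eq_iff)

lemma reparam_box: "x \<in> box L M \<Longrightarrow> (\<And>p j. p < L \<Longrightarrow> j < M \<Longrightarrow> \<iota> p j < N) \<Longrightarrow> reparam L \<iota> x \<in> box L N"
  by (auto simp: reparam_def box_def)

lemma reparam_less:
  assumes "x \<in> box L M" "y \<in> box L M" "p < L" "strict_mono_on {..<M} (\<iota> p)" "x p < y p"
  shows "reparam L \<iota> x p < reparam L \<iota> y p"
  using assms box_less[of x L M p] box_less[of y L M p] by (auto simp: reparam_def strict_mono_on_def)

text \<open>An increasing selection from a strictly sorted list is strictly sorted, so it can be
  read back from its underlying set. This lets a subset of a homogeneous set code a pair of
  points.\<close>

lemma sorted_list_of_set_map_upt:
  fixes idx :: "nat \<Rightarrow> nat"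
  assumes fin: "finite H" and mono: "strict_mono_on {..<n} idx" and bd: "\<And>i. i < n \<Longrightarrow> idx i < card H"
  defines "zs \<equiv> map (\<lambda>i. sorted_list_of_set H ! idx i) [0..<n]"
  shows "sorted_list_of_set (set zs) = zs" "set zs \<in> nsets H n"
proof -
  let ?hs = "sorted_list_of_set H"
  have len: "length ?hs = card H" by simp
  have st: "sorted_wrt (<) ?hs" by (simp add: strict_sorted_iff)
  have lt: "?hs ! idx i < ?hs ! idx j" if "i < j" "j < n" for i j
    using sorted_wrt_nth_less[OF st, of "idx i" "idx j"] mono bd[of j] len that
    by (auto simp: strict_mono_on_def)
  have szs: "sorted_wrt (<) zs"
    unfolding zs_def sorted_wrt_iff_nth_less by (auto simp: lt)
  show "sorted_list_of_set (set zs) = zs"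
    using szs by (simp add: sorted_list_of_set.idem_if_sorted_distinct strict_sorted_iff)
  have "card (set zs) = n"
    using szs distinct_card[of zs] by (simp add: strict_sorted_iff) (simp add: zs_def)
  moreover have "set zs \<subseteq> H"
    using bd len nth_mem[of _ ?hs] fin by (auto simp: zs_def)
  ultimately show "set zs \<in> nsets H n" by (auto simp: nsets_def)
qed

text \<open>Inside a block the increase is \<open>x p < y p\<close>; between blocks it holds because
  every value is below the block length \<open>M\<close>.\<close>

lemma strict_mono_on_interleave:
  fixes x y :: "nat \<Rightarrow> nat"
  assumes "\<And>p. p < L \<Longrightarrow> x p < y p" "\<And>p. p < L \<Longrightarrow> y p < M"
  shows "strict_mono_on {..<2 * L} (\<lambda>i. (i div 2) * M + (if even i then x (i div 2) else y (i div 2)))"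
proof (rule strict_mono_onI)
  fix i j assume ij: "i \<in> {..<2 * L}" "j \<in> {..<2 * L}" "i < j"
  show "(i div 2) * M + (if even i then x (i div 2) else y (i div 2))
      < (j div 2) * M + (if even j then x (j div 2) else y (j div 2))"
  proof (cases "i div 2 = j div 2")
    case True
    then have "even i" "odd j" using ij(3) by presburger+
    then show ?thesis using True ij assms(1)[of "j div 2"] by auto
  next
    case False
    then have "Suc (i div 2) \<le> j div 2" using ij(3) by presburger
    then have "Suc (i div 2) * M \<le> (j div 2) * M" by (rule mult_le_mono1)
    moreover have "(if even i then x (i div 2) else y (i div 2)) < M"
      using assms[of "i div 2"] ij by auto
    ultimately show ?thesis by simp
  qed
qed

text \<open>The diagonal argument: the values at position \<open>p\<close> are taken from the \<open>p\<close>-th block of a single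
  homogeneous set, so that a pair \<open>x < y\<close> is read off from a set of \<open>2 * L\<close> elements.\<close>

lemma product_ramsey:
  fixes C :: "'c set"
  assumes "finite C"
  shows "\<exists>N. \<forall>\<chi>. (\<forall>x y. \<chi> x y \<in> C) \<longrightarrow> (\<exists>\<iota> c. (\<forall>p<L. strict_mono_on {..<M} (\<iota> p)) \<and>
      (\<forall>p<L. \<forall>j<M. \<iota> p j < N) \<and>
      (\<forall>x\<in>box L M. \<forall>y\<in>box L M. (\<forall>p<L. x p < y p) \<longrightarrow> \<chi> (reparam L \<iota> x) (reparam L \<iota> y) = c))"
proof -
  obtain g where g: "bij_betw g C {..<card C}"
    using ex_bij_betw_finite_nat[OF assms] by (auto simp: atLeast0LessThan)
  obtain N :: nat where N: "partn_lst {..<N} (replicate (card C) (L * M)) (2 * L)"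
    using ramsey_full[of "replicate (card C) (L * M)" "2 * L"] by blast
  have "\<exists>\<iota> c. (\<forall>p<L. strict_mono_on {..<M} (\<iota> p)) \<and> (\<forall>p<L. \<forall>j<M. \<iota> p j < N) \<and>
      (\<forall>x\<in>box L M. \<forall>y\<in>box L M. (\<forall>p<L. x p < y p) \<longrightarrow> \<chi> (reparam L \<iota> x) (reparam L \<iota> y) = c)"
    if \<chi>: "\<forall>x y. \<chi> x y \<in> C" for \<chi> :: "(nat \<Rightarrow> nat) \<Rightarrow> (nat \<Rightarrow> nat) \<Rightarrow> 'c"
  proof -
    \<comment> \<open>A \<open>2 * L\<close>-subset is read as a pair: entries of even rank give the
      first point, entries of odd rank the second.\<close>
    define f where "f Z = g (\<chi> (\<lambda>p\<in>{..<L}. sorted_list_of_set Z ! (2 * p))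
      (\<lambda>p\<in>{..<L}. sorted_list_of_set Z ! (2 * p + 1)))" for Z
    have "f \<in> nsets {..<N} (2 * L) \<rightarrow> {..<length (replicate (card C) (L * M))}"
      using g \<chi> by (auto simp: f_def bij_betw_def)
    then obtain i where i: "i < card C" and "monochromatic {..<N} (L * M) (2 * L) f i"
      using N unfolding partn_lst_def by (metis length_replicate nth_replicate)
    then obtain H where H: "H \<in> nsets {..<N} (L * M)" and f: "f ` nsets H (2 * L) \<subseteq> {i}"
      unfolding monochromatic_def by blast
    have finH: "finite H" and cardH: "card H = L * M" and HN: "H \<subseteq> {..<N}"
      using H by (auto simp: nsets_def)
    define hs where "hs = sorted_list_of_set H"
    define \<iota> where "\<iota> p j = hs ! (p * M + j)" for p j
    have st: "sorted_wrt (<) hs" and len: "length hs = L * M" and seths: "set hs = H"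
      using finH cardH by (auto simp: hs_def strict_sorted_iff)
    have idx: "p * M + j < L * M" if "p < L" "j < M" for p j
    proof -
      have "p * M + j < Suc p * M" using that by simp
      also have "\<dots> \<le> L * M" using that by (intro mult_le_mono1) simp
      finally show ?thesis .
    qed
    have "strict_mono_on {..<M} (\<iota> p)" if "p < L" for p
      using that sorted_wrt_nth_less[OF st] idx len by (auto simp: strict_mono_on_def \<iota>_def)
    moreover have "\<iota> p j < N" if "p < L" "j < M" for p j
      using nth_mem[of "p * M + j" hs] idx[OF that] HN len seths by (auto simp: \<iota>_def)
    moreover have "\<chi> (reparam L \<iota> x) (reparam L \<iota> y) = the_inv_into C g i"
      if xy: "x \<in> box L M" "y \<in> box L M" "\<forall>p<L. x p < y p" for x y
    proof -
      define ix where "ix i = (i div 2) * M + (if even i then x (i div 2) else y (i div 2))" for i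
      have mono: "strict_mono_on {..<2 * L} ix"
        unfolding ix_def using xy by (intro strict_mono_on_interleave) (auto dest: box_less)
      have bd: "ix i < card H" if "i < 2 * L" for i
        unfolding ix_def cardH using that xy
        by (auto intro!: idx dest: box_less[of _ _ _ "i div 2"])
      define zs where "zs = map (\<lambda>i. hs ! ix i) [0..<2 * L]"
      have zs: "sorted_list_of_set (set zs) = zs" "set zs \<in> nsets H (2 * L)"
        unfolding zs_def hs_def using sorted_list_of_set_map_upt[OF finH mono bd] by blast+
      have "reparam L \<iota> x = (\<lambda>p\<in>{..<L}. zs ! (2 * p))"
        by (auto simp: reparam_def \<iota>_def zs_def ix_def fun_eq_iff)
      moreover have "reparam L \<iota> y = (\<lambda>p\<in>{..<L}. zs ! (2 * p + 1))"
        by (auto simp: reparam_def \<iota>_def zs_def ix_def fun_eq_iff)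
      ultimately have "f (set zs) = g (\<chi> (reparam L \<iota> x) (reparam L \<iota> y))"
        unfolding f_def zs(1) by simp
      then have "g (\<chi> (reparam L \<iota> x) (reparam L \<iota> y)) = i" using f zs(2) by auto
      then show ?thesis using g \<chi> by (metis bij_betw_def the_inv_into_f_f)
    qed
    ultimately show ?thesis by (intro exI[of _ \<iota>] exI[of _ "the_inv_into C g i"]) auto
  qed
  then show ?thesis by blast
qed

text \<open>One colour records the truth values of all \<open>P \<theta>\<close> on all patterns
  \<open>D\<close>, so a single homogeneous choice serves the whole finite family. The bound
  \<open>N\<close> does not depend on \<open>P\<close>, which allows nested applications.\<close>

lemma pattern_ramsey:
  fixes \<Theta> :: "'a set"
  assumes "finite \<Theta>"
  shows "\<exists>N. \<forall>P. \<exists>\<iota>. (\<forall>p<L. strict_mono_on {..<M} (\<iota> p)) \<and> (\<forall>p<L. \<forall>j<M. \<iota> p j < N) \<and>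
      (\<forall>\<theta>\<in>\<Theta>. pattern_invariant L M (\<lambda>x y. P \<theta> (reparam L \<iota> x) (reparam L \<iota> y)))"
proof -
  have fin: "finite (Pow (\<Theta> \<times> Pow {..<L}))" using assms by simp
  obtain N where N: "\<forall>\<chi>. (\<forall>x y. \<chi> x y \<in> Pow (\<Theta> \<times> Pow {..<L})) \<longrightarrow> (\<exists>\<iota> c. (\<forall>p<L. strict_mono_on {..<M} (\<iota> p)) \<and>
      (\<forall>p<L. \<forall>j<M. \<iota> p j < N) \<and>
      (\<forall>x\<in>box L M. \<forall>y\<in>box L M. (\<forall>p<L. x p < y p) \<longrightarrow> \<chi> (reparam L \<iota> x) (reparam L \<iota> y) = c))"
    using product_ramsey[OF fin, of L M] ..
  show ?thesis
  proof (intro exI[of _ N] allI)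
    fix P :: "'a \<Rightarrow> (nat \<Rightarrow> nat) \<Rightarrow> (nat \<Rightarrow> nat) \<Rightarrow> bool"
    define \<chi> where "\<chi> x y = {(\<theta>, D). \<theta> \<in> \<Theta> \<and> D \<subseteq> {..<L} \<and> P \<theta> x (override_on x y D)}" for x y
    have "\<forall>x y. \<chi> x y \<in> Pow (\<Theta> \<times> Pow {..<L})" by (auto simp: \<chi>_def)
    then obtain \<iota> c where i: "\<forall>p<L. strict_mono_on {..<M} (\<iota> p)" "\<forall>p<L. \<forall>j<M. \<iota> p j < N"
      and c: "\<forall>x\<in>box L M. \<forall>y\<in>box L M. (\<forall>p<L. x p < y p) \<longrightarrow> \<chi> (reparam L \<iota> x) (reparam L \<iota> y) = c"
      using N[THEN spec, of \<chi>] by blast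
    have "pattern_invariant L M (\<lambda>x y. P \<theta> (reparam L \<iota> x) (reparam L \<iota> y))" if "\<theta> \<in> \<Theta>" for \<theta>
      unfolding pattern_invariant_def reparam_override_on
    proof (intro allI impI)
      fix D assume D: "D \<subseteq> {..<L}"
      show "\<exists>t. \<forall>x\<in>box L M. \<forall>y\<in>box L M. (\<forall>p<L. x p < y p) \<longrightarrow>
        P \<theta> (reparam L \<iota> x) (override_on (reparam L \<iota> x) (reparam L \<iota> y) D) = t"
      proof (intro exI[of _ "(\<theta>, D) \<in> c"] ballI impI)
        fix x y assume "x \<in> box L M" "y \<in> box L M" "\<forall>p<L. x p < y p"
        then have "\<chi> (reparam L \<iota> x) (reparam L \<iota> y) = c" using c by blast
        then show "P \<theta> (reparam L \<iota> x) (override_on (reparam L \<iota> x) (reparam L \<iota> y) D) = ((\<theta>, D) \<in> c)"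
          using that D by (auto simp: \<chi>_def)
      qed
    qed
    then show "\<exists>\<iota>. (\<forall>p<L. strict_mono_on {..<M} (\<iota> p)) \<and> (\<forall>p<L. \<forall>j<M. \<iota> p j < N) \<and>
      (\<forall>\<theta>\<in>\<Theta>. pattern_invariant L M (\<lambda>x y. P \<theta> (reparam L \<iota> x) (reparam L \<iota> y)))"
      using i by blast
  qed
qed

section \<open>Homogeneous pairs of codes\<close>

text \<open>Constant points at different levels are comparable at every position, so
  pattern-invariant statements can be tested on them.\<close>

definition diag :: "nat \<Rightarrow> nat \<Rightarrow> nat \<Rightarrow> nat" where
  "diag L j = (\<lambda>p\<in>{..<L}. j)"

lemma diag_box [simp]: "j < M \<Longrightarrow> diag L j \<in> box L M"
  by (auto simp: diag_def box_def)

lemma diag_apply [simp]: "p < L \<Longrightarrow> diag L j p = j"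
  by (simp add: diag_def)

lemma pattern_invariantD:
  assumes "pattern_invariant L M P" "D \<subseteq> {..<L}"
    and "x \<in> box L M" "y \<in> box L M" "\<And>p. p < L \<Longrightarrow> x p < y p"
    and "x' \<in> box L M" "y' \<in> box L M" "\<And>p. p < L \<Longrightarrow> x' p < y' p"
    and "P x (override_on x y D)"
  shows "P x' (override_on x' y' D)"
  using assms unfolding pattern_invariant_def by metis

section \<open>Symmetric differences, and distances as coverage functions\<close>

lemma card_sym_diff_triangle:
  assumes "finite A" "finite B" "finite C"
  shows "card (sym_diff A C) \<le> card (sym_diff A B) + card (sym_diff B C)"
proof -
  have "card (sym_diff A C) \<le> card (sym_diff A B \<union> sym_diff B C)"
    using assms by (intro card_mono) auto
  also have "\<dots> \<le> card (sym_diff A B) + card (sym_diff B C)" by (rule card_Un_le)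
  finally show ?thesis .
qed

lemma card_sym_diff_commute: "card (sym_diff A B) = card (sym_diff B A)"
  by (simp add: Un_commute)

lemma card_sym_diff_Int:
  assumes "finite A" "finite B"
  shows "card (sym_diff A B) + 2 * card (A \<inter> B) = card A + card B"
proof -
  have "card (sym_diff A B) = card (A - B) + card (B - A)"
    using assms by (intro card_Un_disjoint) auto
  moreover have "card A = card (A - B) + card (A \<inter> B)"
    using assms by (subst card_Un_disjoint[symmetric]) (auto intro: arg_cong[where f = card])
  moreover have "card B = card (B - A) + card (A \<inter> B)"
    using assms by (subst card_Un_disjoint[symmetric]) (auto intro: arg_cong[where f = card])
  ultimately show ?thesis by simp
qed

text \<open>Three values per position suffice: if \<open>e a\<close> agrees on \<open>x\<close> and on \<open>x\<close> changed on \<open>D\<close>, the intermediate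
  value shows that it does not depend on any position of \<open>D\<close>. A coincidence between \<open>e a\<close> and \<open>e' b\<close>
  also forces this independence.\<close>

lemma coverage:
  fixes e :: "(nat \<Rightarrow> nat) \<Rightarrow> nat \<Rightarrow> 'b" and e' :: "(nat \<Rightarrow> nat) \<Rightarrow> nat \<Rightarrow> 'b"
  assumes h1: "\<And>a. a < r \<Longrightarrow> pattern_invariant L 3 (\<lambda>x y. e x a = e y a)"
    and h2: "\<And>a b. a < r \<Longrightarrow> b < r' \<Longrightarrow> pattern_invariant L 3 (\<lambda>x y. e x a = e' y b)"
    and inj: "inj_on (e (diag L 0)) {..<r}"
    and inj': "\<And>D. D \<subseteq> {..<L} \<Longrightarrow> inj_on (e' (override_on (diag L 0) (diag L 1) D)) {..<r'}"
  shows "\<exists>m M. (\<forall>p. finite (M p)) \<and> (\<forall>D\<subseteq>{..<L}.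
     card (sym_diff (e (diag L 0) ` {..<r}) (e' (override_on (diag L 0) (diag L 1) D) ` {..<r'})) + 2 * m =
       r + r' + 2 * card (\<Union>p\<in>D. M p :: nat set))"
proof -
  note One_nat_def [simp del]
  let ?x = "diag L 0" and ?y = "diag L 1" and ?z = "diag L 2"
  let ?w = "\<lambda>D. override_on ?x ?y D"
  define fixed where "fixed a D \<longleftrightarrow> e ?x a = e (?w D) a" for a D
  have box [simp]: "?x \<in> box L 3" "?y \<in> box L 3" "?z \<in> box L 3" "?w D \<in> box L 3" for D
    by (simp_all add: override_on_box)
  have wz: "?w D p < ?z p" if "p < L" for D p using that by (simp add: override_on_def)
  \<comment> \<open>Level \<open>2\<close> is a common target: raising \<open>D\<close> to
    \<open>2\<close> from \<open>?x\<close> and from \<open>?w D'\<close> gives the same point, and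
    both moves have pattern \<open>D\<close>.\<close>
  have fixed_mono: "fixed a D'" if D: "D \<subseteq> {..<L}" "D' \<subseteq> D" and a: "a < r" and f: "fixed a D" for a D D'
  proof -
    have "e ?x a = e (override_on ?x ?z D) a"
      using f unfolding fixed_def by (rule pattern_invariantD[OF h1[OF a] D(1), rotated -1]) simp_all
    moreover have "e (?w D') a = e (override_on (?w D') ?z D) a"
      by (rule pattern_invariantD[OF h1[OF a] D(1), of ?x ?y]) (use f wz in \<open>simp_all add: fixed_def\<close>)
    moreover have "override_on (?w D') ?z D = override_on ?x ?z D"
      using D(2) by (auto simp: override_on_def fun_eq_iff)
    ultimately show ?thesis by (simp add: fixed_def)
  qed
  \<comment> \<open>Moving \<open>D\<close> to level \<open>1\<close> and then \<open>D'\<close> to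
    level \<open>2\<close> leaves the element unchanged at each stage. The composite is one move
    from \<open>?x\<close> with pattern \<open>D \<union> D'\<close>.\<close>
  have fixed_Un: "fixed a (D \<union> D')"
    if D: "D \<subseteq> {..<L}" "D' \<subseteq> {..<L}" and a: "a < r" and f: "fixed a D" "fixed a D'" for a D D'
  proof -
    let ?y' = "override_on ?y ?z D'"
    have "e (?w D) a = e (override_on (?w D) ?z D') a"
      by (rule pattern_invariantD[OF h1[OF a] D(2), of ?x ?y]) (use f(2) wz in \<open>simp_all add: fixed_def\<close>)
    then have *: "e ?x a = e (override_on (?w D) ?z D') a" using f(1) by (simp add: fixed_def)
    have "override_on (?w D) ?z D' = override_on ?x ?y' (D \<union> D')" by (auto simp: override_on_def)
    then have "e ?x a = e (override_on ?x ?y' (D \<union> D')) a" using * by simp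
    then show ?thesis unfolding fixed_def
      by (rule pattern_invariantD[OF h1[OF a], of "D \<union> D'" ?x ?y', rotated -1])
        (use D in \<open>auto simp: override_on_box, auto simp: override_on_def\<close>)
  qed
  have fixed_iff: "fixed a D \<longleftrightarrow> (\<forall>p\<in>D. fixed a {p})" if D: "D \<subseteq> {..<L}" and a: "a < r" for a D
  proof
    assume "fixed a D"
    then show "\<forall>p\<in>D. fixed a {p}" using fixed_mono[OF D _ a] by blast
  next
    assume *: "\<forall>p\<in>D. fixed a {p}"
    have "finite D" using D finite_subset by blast
    then show "fixed a D" using * D
    proof (induction D rule: finite_induct)
      case empty
      show ?case by (simp add: fixed_def)
    next
      case (insert p D)
      then show ?case using fixed_Un[of "{p}" D a] a by simp
    qed
  qed
  \<comment> \<open>Partners are sought at the empty pattern only; \<open>shared\<close> shows that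
    other patterns create no new coincidence.\<close>
  define matched where "matched a \<longleftrightarrow> (\<exists>b<r'. e ?x a = e' ?x b)" for a
  have shared: "(\<exists>b<r'. e ?x a = e' (?w D) b) \<longleftrightarrow> matched a \<and> fixed a D"
    if D: "D \<subseteq> {..<L}" and a: "a < r" for a D
  proof
    assume "\<exists>b<r'. e ?x a = e' (?w D) b"
    then obtain b where b: "b < r'" "e ?x a = e' (?w D) b" by blast
    note h = h2[OF a b(1)]
    have "e ?x a = e' (override_on ?x ?z D) b"
      using b(2) by (rule pattern_invariantD[OF h D, rotated -1]) simp_all
    moreover have "e (?w D) a = e' (override_on (?w D) ?z D) b"
      by (rule pattern_invariantD[OF h D, of ?x ?y]) (use b(2) wz in \<open>simp_all add: fixed_def\<close>)
    moreover have "override_on (?w D) ?z D = override_on ?x ?z D" by (auto simp: override_on_def)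
    ultimately have f: "fixed a D" by (simp add: fixed_def)
    then have "e (?w D) a = e' (override_on (?w D) ?z {}) b" using b(2) by (simp add: fixed_def)
    then have "e ?x a = e' (override_on ?x ?y {}) b"
      by (rule pattern_invariantD[OF h empty_subsetI, rotated -1]) (use wz in simp_all)
    then show "matched a \<and> fixed a D" using f b(1) by (auto simp: matched_def)
  next
    assume *: "matched a \<and> fixed a D"
    then obtain b where b: "b < r'" "e ?x a = e' ?x b" by (auto simp: matched_def)
    have "e (?w D) a = e' (override_on (?w D) ?z {}) b"
      by (rule pattern_invariantD[OF h2[OF a b(1)] empty_subsetI, of ?x ?y]) (use b(2) wz in \<open>simp_all add: fixed_def\<close>)
    then show "\<exists>b<r'. e ?x a = e' (?w D) b" using * b by (auto simp: fixed_def)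
  qed
  \<comment> \<open>\<open>M p\<close> collects the matched indices whose element moves with
    position \<open>p\<close>, so the elements still common at \<open>D\<close> are those of
    \<open>A\<close> outside the union.\<close>
  define A where "A = {a. a < r \<and> matched a}"
  define M where "M p = {a. a < r \<and> matched a \<and> \<not> fixed a {p}}" for p
  have finM: "finite (M p)" for p by (simp add: M_def)
  have "card (sym_diff (e ?x ` {..<r}) (e' (?w D) ` {..<r'})) + 2 * card A = r + r' + 2 * card (\<Union>p\<in>D. M p)"
    if D: "D \<subseteq> {..<L}" for D
  proof -
    have "e ?x ` {..<r} \<inter> e' (?w D) ` {..<r'} = e ?x ` {a. a < r \<and> (\<exists>b<r'. e ?x a = e' (?w D) b)}"
      by auto
    also have "{a. a < r \<and> (\<exists>b<r'. e ?x a = e' (?w D) b)} = A - (\<Union>p\<in>D. M p)"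
      using shared[OF D] fixed_iff[OF D] by (auto simp: A_def M_def)
    finally have "card (e ?x ` {..<r} \<inter> e' (?w D) ` {..<r'}) = card (A - (\<Union>p\<in>D. M p))"
      using card_image[OF inj_on_subset[OF inj], of "A - (\<Union>p\<in>D. M p)"] by (auto simp: A_def)
    moreover have "card (A - (\<Union>p\<in>D. M p)) + card (\<Union>p\<in>D. M p) = card A"
    proof -
      have "(\<Union>p\<in>D. M p) \<subseteq> A" "finite A" by (auto simp: A_def M_def)
      then show ?thesis by (metis card_Diff_subset card_mono finite_subset le_add_diff_inverse2)
    qed
    moreover have "card (e ?x ` {..<r}) = r" "card (e' (?w D) ` {..<r'}) = r'"
      using inj inj'[OF D] by (simp_all add: card_image)
    ultimately show ?thesis
      using card_sym_diff_Int[of "e ?x ` {..<r}" "e' (?w D) ` {..<r'}"] by simp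
  qed
  then show ?thesis using finM by blast
qed

text \<open>Positions of \<open>A\<close> are changed one at a time and the triangle inequality adds
  up the costs. The points avoid the top value \<open>M\<close>, which is kept as a spare.\<close>

lemma card_sym_diff_path:
  fixes \<phi> :: "(nat \<Rightarrow> nat) \<Rightarrow> 'b set"
  assumes fin: "\<And>x. finite (\<phi> x)"
    and inv: "pattern_invariant L (Suc M) (\<lambda>x y. card (sym_diff (\<phi> x) (\<phi> y)) \<le> d)"
    and step: "\<And>p. p \<in> A \<Longrightarrow> card (sym_diff (\<phi> (diag L 0)) (\<phi> (override_on (diag L 0) (diag L 1) {p}))) \<le> d"
    and A: "A \<subseteq> {..<L}" and M: "0 < M" and x: "x \<in> box L M" and y: "y \<in> box L M"
  shows "card (sym_diff (\<phi> x) (\<phi> (override_on x y A))) \<le> d * card A"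
proof -
  have "finite A" using A finite_subset by blast
  then show ?thesis using A step
  proof (induction A rule: finite_induct)
    case empty
    show ?case by simp
  next
    case (insert p A)
    have p: "p < L" using insert.prems by simp
    have box: "u \<in> box L (Suc M)" if "u \<in> box L M" for u using that by (rule box_mono) simp
    have up: "card (sym_diff (\<phi> u) (\<phi> (override_on u w {p}))) \<le> d"
      if uw: "u \<in> box L M" "w \<in> box L M" "u p < w p" for u w
    proof -
      \<comment> \<open>At \<open>p\<close> the target is \<open>w p\<close>; elsewhere the spare
        value \<open>M\<close> keeps it strictly above \<open>u\<close>.\<close>
      let ?t = "override_on (diag L M) w {p}"
      have "card (sym_diff (\<phi> u) (\<phi> (override_on u ?t {p}))) \<le> d"
      proof (rule pattern_invariantD[OF inv])
        show "card (sym_diff (\<phi> (diag L 0)) (\<phi> (override_on (diag L 0) (diag L 1) {p}))) \<le> d"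
          using insert.prems(2) by simp
        show "u i < ?t i" if "i < L" for i
          using that uw box_less[OF uw(1)] by (auto simp: override_on_def)
      qed (use p M uw in \<open>simp_all add: box override_on_box\<close>)
      moreover have "override_on u ?t {p} = override_on u w {p}" by (auto simp: override_on_def)
      ultimately show ?thesis by simp
    qed
    let ?u = "override_on x y A"
    have u: "?u \<in> box L M" using x y by (rule override_on_box)
    have eq: "override_on x y (insert p A) = override_on ?u y {p}" by (auto simp: override_on_def)
    have u': "override_on ?u y {p} \<in> box L M" using u y by (rule override_on_box)
    have "card (sym_diff (\<phi> ?u) (\<phi> (override_on ?u y {p}))) \<le> d"
    proof (cases rule: linorder_cases[of "?u p" "y p"])
      case less
      then show ?thesis by (rule up[OF u y])
    next
      case equal
      then have "override_on ?u y {p} = ?u" by (auto simp: override_on_def fun_eq_iff split: if_splits)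
      then show ?thesis by simp
    next
      \<comment> \<open>A decrease at \<open>p\<close> is an increase read backwards.\<close>
      case greater
      then have "card (sym_diff (\<phi> (override_on ?u y {p})) (\<phi> (override_on (override_on ?u y {p}) ?u {p}))) \<le> d"
        by (intro up[OF u' u]) (simp add: override_on_def)
      moreover have "override_on (override_on ?u y {p}) ?u {p} = ?u" by (auto simp: override_on_def)
      ultimately show ?thesis by (simp add: Un_commute)
    qed
    moreover have "card (sym_diff (\<phi> x) (\<phi> ?u)) \<le> d * card A" using insert by simp
    ultimately show ?case
      using card_sym_diff_triangle[OF fin fin fin, of x "override_on x y (insert p A)" ?u] insert.hyps
      by (simp add: eq)
  qed
qed

text \<open>If the distance were at most \<open>k\<close>, two values of \<open>x\<close> at a position of \<open>D\<close> would share a common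
  near point, so that changing any position of \<open>D\<close> would cost at most \<open>2 * k\<close>. The constant \<open>9 * k\<close> is
  \<open>k\<close> plus the cost of four such changes.\<close>

lemma far_apart:
  fixes \<phi> \<psi> :: "(nat \<Rightarrow> nat) \<Rightarrow> 'b set"
  assumes fin: "\<And>x. finite (\<phi> x)" "\<And>x. finite (\<psi> x)" and M: "2 < M"
    and inv: "pattern_invariant L M (\<lambda>x y. card (sym_diff (\<phi> x) (\<phi> y)) \<le> 2 * k)"
      "pattern_invariant L M (\<lambda>x y. card (sym_diff (\<phi> x) (\<psi> y)) \<le> k)"
      "pattern_invariant L M (\<lambda>x y. card (sym_diff (\<phi> x) (\<psi> y)) \<le> 9 * k)"
    and D: "D \<subseteq> {..<L}" "card D \<le> 4"
    and bad: "\<not> card (sym_diff (\<phi> (diag L 0)) (\<psi> (diag L 0))) \<le> 9 * k \<or>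
      (\<exists>p\<in>D. \<not> card (sym_diff (\<phi> (diag L 0)) (\<phi> (override_on (diag L 0) (diag L 1) {p}))) \<le> 2 * k)"
    and xy: "x \<in> box L M" "y \<in> box L M" "\<And>p. p < L \<Longrightarrow> x p < y p"
  shows "k < card (sym_diff (\<phi> x) (\<psi> (override_on x y D)))"
proof (rule ccontr)
  note One_nat_def [simp del]
  let ?x = "diag L 0" and ?y = "diag L 1" and ?z = "diag L 2"
  have [simp]: "?x \<in> box L M" "?y \<in> box L M" "?z \<in> box L M" using M by simp_all
  assume "\<not> ?thesis"
  then have near: "card (sym_diff (\<phi> x) (\<psi> (override_on x y D))) \<le> k" by simp
  have near': "card (sym_diff (\<phi> u) (\<psi> (override_on u w D))) \<le> k"
    if "u \<in> box L M" "w \<in> box L M" "\<And>p. p < L \<Longrightarrow> u p < w p" for u w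
    using near by (rule pattern_invariantD[OF inv(2) D(1), rotated -1]) (use xy that in auto)
  have step: "card (sym_diff (\<phi> ?x) (\<phi> (override_on ?x ?y {p}))) \<le> 2 * k" if p: "p \<in> D" for p
  proof -
    let ?u = "override_on ?x ?y {p}"
    have "card (sym_diff (\<phi> ?x) (\<psi> (override_on ?x ?z D))) \<le> k" by (rule near') simp_all
    moreover have "card (sym_diff (\<phi> ?u) (\<psi> (override_on ?u ?z D))) \<le> k"
      by (rule near'; (rule override_on_box)?; simp add: override_on_def)
    moreover have "override_on ?u ?z D = override_on ?x ?z D" using p by (auto simp: override_on_def)
    ultimately show ?thesis
      using card_sym_diff_triangle[OF fin(1,2,1), of ?x ?u "override_on ?x ?z D"]
        card_sym_diff_commute[of "\<phi> ?u" "\<psi> (override_on ?x ?z D)"] by simp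
  qed
  obtain M' where M': "M = Suc M'" using M by (cases M) auto
  let ?w = "override_on ?x ?y D"
  have wz: "?w \<in> box L M" "\<And>p. p < L \<Longrightarrow> ?w p < ?z p"
    by (simp_all add: override_on_box) (simp add: override_on_def)
  have "card (sym_diff (\<phi> ?x) (\<phi> ?w)) \<le> 2 * k * card D"
    using fin(1) inv(1)[unfolded M'] step D(1) by (rule card_sym_diff_path) (use M M' in auto)
  also have "\<dots> \<le> 2 * k * 4" using D(2) by (rule mult_le_mono2)
  finally have "card (sym_diff (\<phi> ?w) (\<phi> ?x)) \<le> 8 * k" using card_sym_diff_commute[of "\<phi> ?x"] by simp
  moreover have "card (sym_diff (\<phi> ?x) (\<psi> ?w)) \<le> k" by (rule near') simp_all
  ultimately have "card (sym_diff (\<phi> ?w) (\<psi> (override_on ?w ?z {}))) \<le> 9 * k"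
    using card_sym_diff_triangle[OF fin(1,1,2), of ?w ?w ?x] by simp
  \<comment> \<open>The empty pattern carries the bound from \<open>?w\<close> back to
    \<open>?x\<close>, so both alternatives of \<open>bad\<close> fail.\<close>
  then have "card (sym_diff (\<phi> ?x) (\<psi> (override_on ?x ?y {}))) \<le> 9 * k"
    by (rule pattern_invariantD[OF inv(3) empty_subsetI, rotated -1]) (use wz in simp_all)
  then show False using bad step by auto
qed

text \<open>Translating by the code of the point reset to \<open>0\<close> on \<open>A\<close> leaves the distances unchanged between
  points that differ only inside \<open>A\<close>, and makes the sets bounded.\<close>

definition offset ::
  "nat \<Rightarrow> nat set \<Rightarrow> ((nat \<Rightarrow> nat) \<Rightarrow> nat set) \<Rightarrow> ((nat \<Rightarrow> nat) \<Rightarrow> nat set) \<Rightarrow> (nat \<Rightarrow> nat) \<Rightarrow> nat set" where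
  "offset L A \<phi> \<chi> x = sym_diff (\<chi> x) (\<phi> (override_on x (diag L 0) A))"

text \<open>Four predicates are packed into a list indexed by \<open>i\<close> so that they form one
  finite family for Ramsey's theorem. The numbers \<open>a\<close> and \<open>b\<close> are ranks of
  elements in the first two and cardinalities in the last two.\<close>

definition comparison ::
  "nat \<Rightarrow> nat \<Rightarrow> nat \<Rightarrow> ('x \<Rightarrow> nat set) \<Rightarrow> ('x \<Rightarrow> nat set) \<Rightarrow> 'x \<Rightarrow> 'x \<Rightarrow> bool" where
  "comparison i a b T T' x y =
     [sorted_list_of_set (T x) ! a = sorted_list_of_set (T y) ! a,
      sorted_list_of_set (T x) ! a = sorted_list_of_set (T' y) ! b,
      card (T x) = a, card (T' x) = b] ! i"

lemma sorted_list_of_set_nth: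
  assumes "finite A" "card A = r"
  shows "inj_on ((!) (sorted_list_of_set A)) {..<r}" "(!) (sorted_list_of_set A) ` {..<r} = A"
proof -
  show "inj_on ((!) (sorted_list_of_set A)) {..<r}"
    using assms by (auto intro!: inj_on_nth)
  show "(!) (sorted_list_of_set A) ` {..<r} = A"
    using assms nth_image[of r "sorted_list_of_set A"] by (simp add: lessThan_atLeast0)
qed

text \<open>The offsets are sets of bounded size, and \<open>coverage\<close> applies to their
  increasing enumerations. The values of \<open>\<iota>\<close> stay below \<open>M\<close>, which
  leaves spare values for comparison points in the invariance over \<open>M + 3\<close>
  values.\<close>

lemma distance_coverage:
  fixes \<phi> \<psi> :: "(nat \<Rightarrow> nat) \<Rightarrow> nat set"
  assumes fin: "\<And>x. finite (\<phi> x)" "\<And>x. finite (\<psi> x)"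
    and inv: "pattern_invariant L (M + 3) (\<lambda>x y. card (sym_diff (\<phi> x) (\<phi> y)) \<le> 2 * k)"
      "pattern_invariant L (M + 3) (\<lambda>x y. card (sym_diff (\<phi> x) (\<psi> y)) \<le> 9 * k)"
    and near: "card (sym_diff (\<phi> (diag L 0)) (\<psi> (diag L 0))) \<le> 9 * k"
    and A: "A \<subseteq> {..<L}"
    and step: "\<And>p. p \<in> A \<Longrightarrow> card (sym_diff (\<phi> (diag L 0)) (\<phi> (override_on (diag L 0) (diag L 1) {p}))) \<le> 2 * k"
    and bd: "\<And>p j. p < L \<Longrightarrow> j < 3 \<Longrightarrow> \<iota> p j < M"
    and cmp: "\<And>i a b. i < 4 \<Longrightarrow> a < 9 * k + 2 * k * L + 1 \<Longrightarrow> b < 9 * k + 2 * k * L + 1 \<Longrightarrow>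
      pattern_invariant L 3 (\<lambda>x y. comparison i a b (offset L A \<phi> \<phi>) (offset L A \<phi> \<psi>) (reparam L \<iota> x) (reparam L \<iota> y))"
  defines "X \<equiv> reparam L \<iota> (diag L 0)" and "Y \<equiv> reparam L \<iota> (diag L 1)"
  shows "\<exists>m r N. (\<forall>p\<in>A. finite (N p) \<and> card (N p) \<le> 10 * k) \<and>
    (\<forall>D\<subseteq>A. card (sym_diff (\<phi> X) (\<psi> (override_on X Y D))) + 2 * m = r + 2 * card (\<Union>p\<in>D. N p :: nat set))"
proof -
  note One_nat_def [simp del]
  \<comment> \<open>A strict bound on both offset sizes: \<open>2 * k\<close> for each of at most
    \<open>L\<close> reset positions, and \<open>9 * k\<close> for passing from
    \<open>\<phi>\<close> to \<open>\<psi>\<close>.\<close>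
  define R where "R = 9 * k + 2 * k * L + 1"
  let ?T = "offset L A \<phi> \<phi>" and ?T' = "offset L A \<phi> \<psi>"
  have finT [simp]: "finite (?T x)" "finite (?T' x)" for x using fin by (simp_all add: offset_def)
  have card_A: "card A \<le> L" using A card_mono[of "{..<L}" A] by auto
  have box: "x \<in> box L (M + 3)" "x \<in> box L (M + 2)" if "x \<in> box L M" for x
    using that by (simp_all add: box_mono)
  have path: "card (sym_diff (\<phi> x) (\<phi> (override_on x y D))) \<le> 2 * k * card D"
    if "x \<in> box L (M + 2)" "y \<in> box L (M + 2)" "D \<subseteq> A" for x y D
    by (rule card_sym_diff_path[OF fin(1), of L "M + 2"])
      (use inv(1) step A that in \<open>auto simp: numeral_3_eq_3 numeral_2_eq_2\<close>)
  have near': "card (sym_diff (\<phi> x) (\<psi> x)) \<le> 9 * k" if x: "x \<in> box L M" for x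
  proof -
    have "card (sym_diff (\<phi> x) (\<psi> (override_on x (diag L M) {}))) \<le> 9 * k"
      by (rule pattern_invariantD[OF inv(2) empty_subsetI, of "diag L 0" "diag L 1"])
        (use near box[OF x] box_less[OF x] in simp_all)
    then show ?thesis by simp
  qed
  have cardT: "card (?T x) < R" if x: "x \<in> box L M" for x
  proof -
    have "card (?T x) \<le> 2 * k * card A"
      unfolding offset_def using path[OF box(2)[OF x], of "diag L 0" A] by simp
    also have "\<dots> \<le> 2 * k * L" using card_A by (rule mult_le_mono2)
    finally show ?thesis by (simp add: R_def)
  qed
  have cardT': "card (?T' x) < R" if x: "x \<in> box L M" for x
  proof -
    have "card (?T' x) \<le> card (sym_diff (\<psi> x) (\<phi> x)) + card (?T x)"
      unfolding offset_def by (rule card_sym_diff_triangle) (use fin in auto)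
    moreover have "card (?T x) \<le> 2 * k * card A"
      unfolding offset_def using path[OF box(2)[OF x], of "diag L 0" A] by simp
    moreover have "2 * k * card A \<le> 2 * k * L" using card_A by (rule mult_le_mono2)
    moreover have "card (sym_diff (\<psi> x) (\<phi> x)) \<le> 9 * k"
      using near'[OF x] by (simp only: card_sym_diff_commute[of "\<psi> x"])
    ultimately show ?thesis unfolding R_def by linarith
  qed
  have lift: "reparam L \<iota> x \<in> box L M" if "x \<in> box L 3" for x
    using that bd by (rule reparam_box)
  let ?r = "card (?T X)" and ?r' = "card (?T' X)"
  have XY: "X \<in> box L M" "Y \<in> box L M" by (simp_all add: X_def Y_def lift)
  have r: "?r < R" "?r' < R" using cardT cardT' XY by simp_all
  have XY_D: "override_on X Y D = reparam L \<iota> (override_on (diag L 0) (diag L 1) D)" for D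
    by (simp add: X_def Y_def reparam_override_on)
  \<comment> \<open>This predicate involves only the first point, so the empty pattern already makes
    the size of \<open>?T'\<close> constant and gives the enumerations a common length.\<close>
  have r': "card (?T' (override_on X Y D)) = ?r'" for D
  proof -
    have "comparison 3 0 ?r' ?T ?T' (reparam L \<iota> (override_on (diag L 0) (diag L 1) D))
      (reparam L \<iota> (override_on (override_on (diag L 0) (diag L 1) D) (diag L 2) {}))"
      by (rule pattern_invariantD[OF cmp[of 3 0 ?r'] empty_subsetI, of "diag L 0" "diag L 1"])
        (use r(2) in \<open>auto simp: R_def comparison_def X_def override_on_box, auto simp: override_on_def\<close>)
    then show ?thesis by (simp add: comparison_def XY_D)
  qed
  have "\<exists>m N. (\<forall>p. finite (N p)) \<and> (\<forall>D\<subseteq>{..<L}.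
     card (sym_diff ((!) (sorted_list_of_set (?T (reparam L \<iota> (diag L 0)))) ` {..<?r})
       ((!) (sorted_list_of_set (?T' (reparam L \<iota> (override_on (diag L 0) (diag L 1) D)))) ` {..<?r'})) + 2 * m =
       ?r + ?r' + 2 * card (\<Union>p\<in>D. N p :: nat set))"
  proof (rule coverage)
    show "pattern_invariant L 3 (\<lambda>x y. sorted_list_of_set (?T (reparam L \<iota> x)) ! a = sorted_list_of_set (?T (reparam L \<iota> y)) ! a)"
      if "a < ?r" for a
      using cmp[of 0 a 0] that r unfolding R_def by (simp add: comparison_def)
    show "pattern_invariant L 3 (\<lambda>x y. sorted_list_of_set (?T (reparam L \<iota> x)) ! a = sorted_list_of_set (?T' (reparam L \<iota> y)) ! b)"
      if "a < ?r" "b < ?r'" for a b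
      using cmp[of 1 a b] that r unfolding R_def by (simp add: comparison_def)
    show "inj_on ((!) (sorted_list_of_set (?T (reparam L \<iota> (diag L 0))))) {..<?r}"
      by (rule sorted_list_of_set_nth) (simp_all add: X_def)
    show "inj_on ((!) (sorted_list_of_set (?T' (reparam L \<iota> (override_on (diag L 0) (diag L 1) D))))) {..<?r'}" for D
      by (rule sorted_list_of_set_nth) (simp_all add: r'[unfolded XY_D])
  qed
  then obtain m N where N: "\<And>p. finite (N p)" and eq: "\<And>D. D \<subseteq> {..<L} \<Longrightarrow>
     card (sym_diff (?T X) (?T' (override_on X Y D))) + 2 * m = ?r + ?r' + 2 * card (\<Union>p\<in>D. N p :: nat set)"
    unfolding X_def[symmetric] XY_D[symmetric] sorted_list_of_set_nth(2)[OF finT(1) refl]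
      sorted_list_of_set_nth(2)[OF finT(2) r'] by blast
  have eq': "card (sym_diff (\<phi> X) (\<psi> (override_on X Y D))) + 2 * m = ?r + ?r' + 2 * card (\<Union>p\<in>D. N p)"
    if D: "D \<subseteq> A" for D
  proof -
    \<comment> \<open>Resetting on \<open>A\<close> erases the change on \<open>D\<close>, so both
      offsets use the same translate, which cancels in the symmetric difference.\<close>
    have "override_on (override_on X Y D) (diag L 0) A = override_on X (diag L 0) A"
      using D by (auto simp: override_on_def fun_eq_iff)
    then have "sym_diff (?T X) (?T' (override_on X Y D)) = sym_diff (\<phi> X) (\<psi> (override_on X Y D))"
      by (auto simp: offset_def)
    then show ?thesis using eq[of D] D A by auto
  qed
  have "card (N p) \<le> 10 * k" if p: "p \<in> A" for p
  proof -
    let ?Z = "override_on X Y {p}"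
    have Z: "?Z \<in> box L M" using XY by (rule override_on_box)
    have "card (sym_diff (\<phi> X) (\<phi> ?Z)) \<le> 2 * k"
      using path[of X Y "{p}"] p XY box by simp
    moreover have "card (sym_diff (\<phi> X) (\<psi> ?Z)) \<le> card (sym_diff (\<phi> X) (\<phi> ?Z)) + card (sym_diff (\<phi> ?Z) (\<psi> ?Z))"
      using fin by (intro card_sym_diff_triangle)
    ultimately have "card (sym_diff (\<phi> X) (\<psi> ?Z)) \<le> 11 * k" using near'[OF Z] by simp
    moreover have "card (sym_diff (\<phi> X) (\<psi> ?Z)) + 2 * m = ?r + ?r' + 2 * card (N p)"
      using eq'[of "{p}"] p by simp
    \<comment> \<open>Hence \<open>2 * card (N p)\<close> is at most the distance, which is at most
      \<open>11 * k\<close>.\<close>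
    moreover have "2 * m \<le> ?r + ?r'" using eq'[of "{}"] by simp
    ultimately show ?thesis by linarith
  qed
  then have "\<forall>p\<in>A. finite (N p) \<and> card (N p) \<le> 10 * k" using N by simp
  moreover have "\<forall>D\<subseteq>A. card (sym_diff (\<phi> X) (\<psi> (override_on X Y D))) + 2 * m =
    (?r + ?r') + 2 * card (\<Union>p\<in>D. N p)" using eq' by simp
  ultimately show ?thesis by (intro exI conjI)
qed

section \<open>Sunflowers and a balanced choice of positions\<close>

lemma pigeonhole_fibre:
  assumes "finite C" "f ` A \<subseteq> C" "card C * m < card A"
  shows "\<exists>c\<in>C. m < card {a \<in> A. f a = c}"
proof -
  have fin: "finite A" using assms(3) by (metis card.infinite not_less_zero)
  have ne: "C \<noteq> {}" using assms by auto
  have "\<exists>y\<in>C. card (f -` {y} \<inter> A) * card C \<ge> card A"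
    using assms fin ne by (intro pigeonhole_card) auto
  then obtain y where y: "y \<in> C" "card A \<le> card (f -` {y} \<inter> A) * card C" by blast
  have "card C * m < card C * card (f -` {y} \<inter> A)" 
    using order.strict_trans2[OF assms(3) y(2)] by (simp only: mult.commute)
  then have "m < card (f -` {y} \<inter> A)" by simp
  moreover have "f -` {y} \<inter> A = {a \<in> A. f a = y}" by auto
  ultimately show ?thesis using y(1) by auto
qed

text \<open>The Erdos-Rado induction, for indexed families in which different indices may carry the
  same set. A maximal disjoint subfamily either has \<open>m\<close> members, or its union is a
  small set met by every other member; pigeonhole then gives many members a common element, which is
  removed.\<close>

lemma sunflower:
  "\<exists>n. \<forall>(N :: 'a \<Rightarrow> 'b set) B. n < card B \<longrightarrow> (\<forall>b\<in>B. finite (N b) \<and> card (N b) \<le> K) \<longrightarrow>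
     (\<exists>B' Y. B' \<subseteq> B \<and> card B' = m \<and> (\<forall>b\<in>B'. \<forall>b'\<in>B'. b \<noteq> b' \<longrightarrow> N b \<inter> N b' = Y))"
proof (induction K)
  case 0
  show ?case
  proof (rule exI[of _ m], intro allI impI)
    fix N :: "'a \<Rightarrow> 'b set" and B assume "m < card B" and N: "\<forall>b\<in>B. finite (N b) \<and> card (N b) \<le> 0"
    then obtain B' where "B' \<subseteq> B" "card B' = m" by (meson less_imp_le obtain_subset_with_card_n)
    moreover have "\<forall>b\<in>B. N b = {}" using N by auto
    ultimately show "\<exists>B' Y. B' \<subseteq> B \<and> card B' = m \<and> (\<forall>b\<in>B'. \<forall>b'\<in>B'. b \<noteq> b' \<longrightarrow> N b \<inter> N b' = Y)"
      by (intro exI[of _ B'] exI[of _ "{}"]) auto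
  qed
next
  case (Suc K)
  then obtain n where n: "\<forall>(N :: 'a \<Rightarrow> 'b set) B. n < card B \<longrightarrow> (\<forall>b\<in>B. finite (N b) \<and> card (N b) \<le> K) \<longrightarrow>
     (\<exists>B' Y. B' \<subseteq> B \<and> card B' = m \<and> (\<forall>b\<in>B'. \<forall>b'\<in>B'. b \<noteq> b' \<longrightarrow> N b \<inter> N b' = Y))" ..
  show ?case
  \<comment> \<open>\<open>m * Suc K\<close> bounds the union of the disjoint subfamily, more than
    \<open>n\<close> members are needed in one fibre, and the last \<open>m\<close> pays for
    discarding the subfamily.\<close>
  proof (rule exI[of _ "(m * Suc K) * n + m"], intro allI impI)
    fix N :: "'a \<Rightarrow> 'b set" and B
    assume card: "(m * Suc K) * n + m < card B" and N: "\<forall>b\<in>B. finite (N b) \<and> card (N b) \<le> Suc K"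
    have finB: "finite B" using card by (intro card_ge_0_finite) linarith
    define S where "S = {B'. B' \<subseteq> B \<and> (\<forall>b\<in>B'. \<forall>b'\<in>B'. b \<noteq> b' \<longrightarrow> N b \<inter> N b' = {})}"
    have "finite S" using finB by (auto simp: S_def)
    moreover have "{} \<in> S" by (auto simp: S_def)
    ultimately have "\<exists>B0\<in>S. {} \<subseteq> B0 \<and> (\<forall>B'\<in>S. B0 \<subseteq> B' \<longrightarrow> B0 = B')"
      by (rule finite_has_maximal2)
    then obtain B0 where B0: "B0 \<in> S" and max: "\<forall>B'\<in>S. B0 \<subseteq> B' \<longrightarrow> B0 = B'"
      by (elim bexE conjE)
    show "\<exists>B' Y. B' \<subseteq> B \<and> card B' = m \<and> (\<forall>b\<in>B'. \<forall>b'\<in>B'. b \<noteq> b' \<longrightarrow> N b \<inter> N b' = Y)"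
    proof (cases "m \<le> card B0")
      case True
      then obtain B' where "B' \<subseteq> B0" "card B' = m" by (meson obtain_subset_with_card_n)
      moreover have "\<forall>b\<in>B0. \<forall>b'\<in>B0. b \<noteq> b' \<longrightarrow> N b \<inter> N b' = {}" "B0 \<subseteq> B"
        using B0 by (simp_all add: S_def)
      ultimately show ?thesis by (intro exI[of _ B'] exI[of _ "{}"]) (meson subset_iff)
    next
      case False
      have B0B: "B0 \<subseteq> B" using B0 by (auto simp: S_def)
      define U where "U = (\<Union>b\<in>B0. N b)"
      have finB0: "finite B0" using B0B finB finite_subset by blast
      have finU: "finite U" unfolding U_def using B0B N finB0 by auto
      have "card U \<le> (\<Sum>b\<in>B0. card (N b))" unfolding U_def by (rule card_UN_le[OF finB0])
      also have "\<dots> \<le> card B0 * Suc K" using sum_bounded_above[of B0 "\<lambda>b. card (N b)" "Suc K"] N B0B by auto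
      also have "\<dots> \<le> m * Suc K" using False by (intro mult_le_mono1) simp
      finally have cU: "card U \<le> m * Suc K" .
      have hit: "\<exists>u. u \<in> N b \<inter> U" if b: "b \<in> B - B0" for b
      proof (rule ccontr)
        assume no: "\<nexists>u. u \<in> N b \<inter> U"
        then have "insert b B0 \<in> S" using B0 b unfolding S_def U_def by (simp; blast)
        then show False using max b by auto
      qed
      then obtain f where f: "\<And>b. b \<in> B - B0 \<Longrightarrow> f b \<in> N b \<inter> U" by metis
      have "card U * n \<le> m * Suc K * n" using cU by (rule mult_le_mono1)
      also have "\<dots> < card (B - B0)" using card card_Diff_subset[OF finB0 B0B] False by linarith
      finally obtain u where u: "u \<in> U" "n < card {b \<in> B - B0. f b = u}"
        using pigeonhole_fibre[OF finU, of f "B - B0" n] f by blast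
      define B1 where "B1 = {b \<in> B - B0. f b = u}"
      have uN: "u \<in> N b" if "b \<in> B1" for b using that f unfolding B1_def by auto
      have "\<forall>b\<in>B1. finite (N b - {u}) \<and> card (N b - {u}) \<le> K"
        using N uN by (auto simp: B1_def card_Diff_singleton)
      with n[THEN spec, THEN spec, THEN mp, THEN mp, of B1 "\<lambda>b. N b - {u}"] u(2)[folded B1_def]
      obtain B' Y where B': "B' \<subseteq> B1" "card B' = m"
        "\<forall>b\<in>B'. \<forall>b'\<in>B'. b \<noteq> b' \<longrightarrow> (N b - {u}) \<inter> (N b' - {u}) = Y"
        by blast
      have "N b \<inter> N b' = insert u Y" if "b \<in> B'" "b' \<in> B'" "b \<noteq> b'" for b b'
      proof -
        have "(N b - {u}) \<inter> (N b' - {u}) = Y" using B'(3) that by blast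
        moreover have "u \<in> N b" "u \<in> N b'" using uN B'(1) that by auto
        ultimately show ?thesis by auto
      qed
      then show ?thesis using B' by (intro exI[of _ B'] exI[of _ "insert u Y"]) (auto simp: B1_def)
    qed
  qed
qed

text \<open>The parts outside the kernel \<open>Y\<close> are disjoint. If each of them met
  \<open>U\<close>, choosing a common element would inject \<open>B\<close> into
  \<open>U\<close>.\<close>

lemma sunflower_avoid:
  assumes sun: "\<And>b b'. b \<in> B \<Longrightarrow> b' \<in> B \<Longrightarrow> b \<noteq> b' \<Longrightarrow> N b \<inter> N b' = Y"
    and fin: "finite U" and card: "card U < card B"
  shows "\<exists>b\<in>B. N b \<inter> U \<subseteq> Y"
proof (rule ccontr)
  assume "\<not> ?thesis"
  then have "\<exists>u. u \<in> N b \<inter> U - Y" if "b \<in> B" for b using that by blast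
  then obtain f where f: "\<And>b. b \<in> B \<Longrightarrow> f b \<in> N b \<inter> U - Y" by metis
  have "inj_on f B"
  proof (rule inj_onI, rule ccontr)
    fix b b' assume b: "b \<in> B" "b' \<in> B" "f b = f b'" "b \<noteq> b'"
    then have "f b \<in> N b \<inter> N b'" using f by (metis DiffD1 IntE IntI)
    then show False using sun[OF b(1,2,4)] f[OF b(1)] by auto
  qed
  then have "card B \<le> card U" using f fin by (intro card_inj_on_le[of f]) auto
  then show False using card by simp
qed

text \<open>With \<open>b1\<close>, \<open>b2\<close> in one row and \<open>b3\<close>, \<open>b4\<close>, \<open>b5\<close> in another, the two unions arise from
  \<open>M v b1 \<union> M v b3 \<union> M v b4\<close> by adding \<open>M v b2\<close> or \<open>M v b5\<close>. Both are chosen to contribute exactly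
  their petal, and petals have the same size in both rows.\<close>

lemma balanced_configuration:
  "\<exists>R s. \<forall>(W :: nat \<Rightarrow> nat set) (M :: nat \<Rightarrow> nat \<Rightarrow> 'e set).
     (\<forall>p<R * s. W p \<subseteq> {..<q} \<and> (\<forall>v\<in>W p. finite (M v p) \<and> card (M v p) \<le> K)) \<longrightarrow>
     (\<exists>b1 b2 b3 b4 b5. {b1, b2, b3, b4, b5} \<subseteq> {..<R * s} \<and> distinct [b1, b2, b3, b4, b5] \<and>
        b2 div s = b1 div s \<and> b4 div s = b3 div s \<and> b5 div s = b3 div s \<and> b1 div s \<noteq> b3 div s \<and>
        (\<forall>b\<in>{b1, b2, b3, b4, b5}. W b = W b1) \<and>
        (\<forall>v\<in>W b1. card (\<Union>b\<in>{b1, b2, b3, b4}. M v b) = card (\<Union>b\<in>{b1, b3, b4, b5}. M v b)))"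
proof -
  \<comment> \<open>The position \<open>b2\<close> must avoid two sets of size at most
    \<open>q * K\<close>, and up to two positions of a row are already taken; \<open>3\<close> keeps
    the inequalities strict.\<close>
  define m where "m = 2 * (q * K) + 3"
  define C where "C = Pow ({..<q} \<times> {..K})"
  have finC: "finite C" by (simp add: C_def)
  obtain n where n: "\<forall>(N :: nat \<Rightarrow> (nat \<times> 'e) set) B. n < card B \<longrightarrow>
     (\<forall>b\<in>B. finite (N b) \<and> card (N b) \<le> q * K) \<longrightarrow>
     (\<exists>B' Y. B' \<subseteq> B \<and> card B' = m \<and> (\<forall>b\<in>B'. \<forall>b'\<in>B'. b \<noteq> b' \<longrightarrow> N b \<inter> N b' = Y))"
    using sunflower[of "q * K" m] ..
  \<comment> \<open>A row is long enough for a sunflower among positions of equal type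
    \<open>\<Gamma>\<close>, and there are enough rows for two of them to share
    \<open>\<gamma>\<close>.\<close>
  define s where "s = Suc (card C * n)"
  define R where "R = Suc (card (C \<times> C) * 1)"
  show ?thesis
  proof (rule exI[of _ R], rule exI[of _ s], intro allI impI)
    fix W :: "nat \<Rightarrow> nat set" and M :: "nat \<Rightarrow> nat \<Rightarrow> 'e set"
    assume *: "\<forall>p<R * s. W p \<subseteq> {..<q} \<and> (\<forall>v\<in>W p. finite (M v p) \<and> card (M v p) \<le> K)"
    have W: "W p \<subseteq> {..<q}" if "p < R * s" for p using * that by blast
    have M: "finite (M v p)" "card (M v p) \<le> K" if "p < R * s" "v \<in> W p" for v p using * that by blast+
    \<comment> \<open>The sets for all queries form a disjoint union, so a single sunflower handles
      every \<open>v\<close> at once; the slice of its kernel at \<open>v\<close> is the kernel for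
      \<open>M v\<close>. The type \<open>\<Gamma> p\<close> determines \<open>W p\<close> as well
      as all set sizes.\<close>
    define N where "N p = Sigma (W p) (\<lambda>v. M v p)" for p
    define \<Gamma> where "\<Gamma> p = (\<lambda>v. (v, card (M v p))) ` W p" for p
    have finW: "finite (W p)" and cardW: "card (W p) \<le> q" if "p < R * s" for p
      using W[OF that] by (auto intro: finite_subset dest: card_mono[rotated])
    have N: "finite (N p) \<and> card (N p) \<le> q * K" if p: "p < R * s" for p
    proof -
      have "card (N p) = (\<Sum>v\<in>W p. card (M v p))"
        unfolding N_def by (rule card_SigmaI) (use finW M p in auto)
      also have "\<dots> \<le> card (W p) * K" using sum_bounded_above[of "W p" "\<lambda>v. card (M v p)" K] M p by auto
      also have "\<dots> \<le> q * K" using cardW[OF p] by (rule mult_le_mono1)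
      finally show ?thesis unfolding N_def using finW M p by auto
    qed
    define P where "P i B g Y \<longleftrightarrow> B \<subseteq> {i * s..<i * s + s} \<and> card B = m \<and> g \<in> C \<and> (\<forall>b\<in>B. \<Gamma> b = g) \<and>
        (\<forall>b\<in>B. \<forall>b'\<in>B. b \<noteq> b' \<longrightarrow> N b \<inter> N b' = Y)" for i B g Y
    have "\<exists>B g Y. P i B g Y" if i: "i < R" for i
    proof -
      have lt: "p < R * s" if "p \<in> {i * s..<i * s + s}" for p
      proof -
        have "p < Suc i * s" using that by simp
        also have "\<dots> \<le> R * s" using i by (intro mult_le_mono1) simp
        finally show ?thesis .
      qed
      have "\<Gamma> ` {i * s..<i * s + s} \<subseteq> C"
        using lt W M by (fastforce simp: \<Gamma>_def C_def)
      moreover have "card C * n < card {i * s..<i * s + s}" by (simp add: s_def)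
      ultimately obtain g where g: "g \<in> C" "n < card {p \<in> {i * s..<i * s + s}. \<Gamma> p = g}"
        using pigeonhole_fibre[OF finC, of \<Gamma> "{i * s..<i * s + s}" n] by blast
      have "\<forall>b\<in>{p \<in> {i * s..<i * s + s}. \<Gamma> p = g}. finite (N b) \<and> card (N b) \<le> q * K"
        using N lt by blast
      from n[THEN spec, THEN spec, THEN mp, THEN mp, OF g(2) this]
      obtain B Y where BY: "B \<subseteq> {p \<in> {i * s..<i * s + s}. \<Gamma> p = g}" "card B = m"
        "\<forall>b\<in>B. \<forall>b'\<in>B. b \<noteq> b' \<longrightarrow> N b \<inter> N b' = Y"
        by (elim exE conjE)
      then have "P i B g Y" using g(1) unfolding P_def by blast
      then show ?thesis by blast
    qed
    then obtain D g Y where "\<forall>i<R. P i (D i) (g i) (Y i)" by metis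
    then have D: "D i \<subseteq> {i * s..<i * s + s}" "card (D i) = m" "g i \<in> C" "\<And>b. b \<in> D i \<Longrightarrow> \<Gamma> b = g i"
      "\<And>b b'. b \<in> D i \<Longrightarrow> b' \<in> D i \<Longrightarrow> b \<noteq> b' \<Longrightarrow> N b \<inter> N b' = Y i" if "i < R" for i
      using that unfolding P_def by blast+
    \<comment> \<open>Kernel sizes are cut off at \<open>v < q\<close> and \<open>c \<le> K\<close>
      to leave finitely many values; the slices with \<open>v\<close> in \<open>W b1\<close> are
      within the cutoff.\<close>
    define \<gamma> where "\<gamma> i = (g i, {(v, c). v < q \<and> c \<le> K \<and> c = card (Y i `` {v})})" for i
    have "\<gamma> ` {..<R} \<subseteq> C \<times> C" using D(3) by (auto simp: \<gamma>_def C_def)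
    moreover have "card (C \<times> C) * 1 < card {..<R}" by (simp add: R_def)
    ultimately obtain c where "1 < card {i \<in> {..<R}. \<gamma> i = c}"
      using pigeonhole_fibre[of "C \<times> C" \<gamma> "{..<R}" 1] finC by blast
    then obtain i j where ij: "i < R" "j < R" "i \<noteq> j" "\<gamma> i = \<gamma> j"
      using card_le_Suc0_iff_eq[of "{i \<in> {..<R}. \<gamma> i = c}"] by fastforce
    show "\<exists>b1 b2 b3 b4 b5. {b1, b2, b3, b4, b5} \<subseteq> {..<R * s} \<and> distinct [b1, b2, b3, b4, b5] \<and>
        b2 div s = b1 div s \<and> b4 div s = b3 div s \<and> b5 div s = b3 div s \<and> b1 div s \<noteq> b3 div s \<and>
        (\<forall>b\<in>{b1, b2, b3, b4, b5}. W b = W b1) \<and>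
        (\<forall>v\<in>W b1. card (\<Union>b\<in>{b1, b2, b3, b4}. M v b) = card (\<Union>b\<in>{b1, b3, b4, b5}. M v b))"
    proof -
      have lt: "p < R * s" "p div s = i" if "p \<in> D i" "i < R" for p i
      proof -
        have p: "i * s \<le> p" "p < i * s + s" using that D(1)[OF that(2)] by auto
        then have "p < Suc i * s" by simp
        also have "\<dots> \<le> R * s" using that by (intro mult_le_mono1) simp
        finally show "p < R * s" .
        show "p div s = i" using p by (intro div_nat_eqI) (simp_all add: mult.commute)
      qed
      have finD: "finite (D i)" "finite (D j)" using D(2) ij by (auto intro!: card_ge_0_finite simp: m_def)
      have WF: "W b = fst ` \<Gamma> b" for b by (auto simp: \<Gamma>_def image_image)
      have g: "g i = g j" using ij(4) by (simp add: \<gamma>_def)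
      obtain b1 where b1: "b1 \<in> D i" using D(2)[OF ij(1)] by (fastforce simp: m_def)
      obtain b3 where b3: "b3 \<in> D j" using D(2)[OF ij(2)] by (fastforce simp: m_def)
      have "card (D j - {b3}) = 2 * (q * K) + 2" using D(2)[OF ij(2)] b3 finD by (simp add: m_def)
      then have "D j - {b3} \<noteq> {}" by (metis card.empty add_is_0 zero_neq_numeral)
      then obtain b4 where b4: "b4 \<in> D j" "b4 \<noteq> b3" by blast
      note bR = lt(1)[OF b1 ij(1)] lt(1)[OF b3 ij(2)] lt(1)[OF b4(1) ij(2)]
      have "\<exists>b\<in>D i - {b1}. N b \<inter> (N b3 \<union> N b4) \<subseteq> Y i"
      proof (rule sunflower_avoid)
        show "finite (N b3 \<union> N b4)" using N bR by blast
        have "card (N b3 \<union> N b4) \<le> card (N b3) + card (N b4)" by (rule card_Un_le)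
        also have "\<dots> \<le> q * K + q * K" using N bR by (intro add_mono) blast+
        also have "\<dots> < card (D i - {b1})" using D(2)[OF ij(1)] b1 finD by (simp add: m_def)
        finally show "card (N b3 \<union> N b4) < card (D i - {b1})" .
      qed (use D(5)[OF ij(1)] in blast)
      then obtain b2 where b2: "b2 \<in> D i" "b2 \<noteq> b1" "N b2 \<inter> (N b3 \<union> N b4) \<subseteq> Y i" by blast
      have "\<exists>b\<in>D j - {b3, b4}. N b \<inter> N b1 \<subseteq> Y j"
      proof (rule sunflower_avoid)
        show "finite (N b1)" using N bR by blast
        have "card (N b1) \<le> q * K" using N bR by blast
        also have "\<dots> < card (D j - {b3, b4})" using D(2)[OF ij(2)] b3 b4 finD by (simp add: m_def)
        finally show "card (N b1) < card (D j - {b3, b4})" .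
      qed (use D(5)[OF ij(2)] in blast)
      then obtain b5 where b5: "b5 \<in> D j" "b5 \<noteq> b3" "b5 \<noteq> b4" "N b5 \<inter> N b1 \<subseteq> Y j" by blast
      have \<Gamma>: "\<Gamma> b = g i" if "b \<in> {b1, b2, b3, b4, b5}" for b
        using that D(4) ij b1 b2 b3 b4 b5 g by auto
      have WW: "W b = W b1" if "b \<in> {b1, b2, b3, b4, b5}" for b
        using \<Gamma>[OF that] \<Gamma>[of b1] by (simp add: WF)
      have Mv: "M v b = N b `` {v}" if "v \<in> W b1" "b \<in> {b1, b2, b3, b4, b5}" for v b
        using that(1) WW[OF that(2)] by (auto simp: N_def)
      have main: "card (\<Union>b\<in>{b1, b2, b3, b4}. M v b) = card (\<Union>b\<in>{b1, b3, b4, b5}. M v b)" if v: "v \<in> W b1" for v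
      proof -
        let ?U = "M v b1 \<union> M v b3 \<union> M v b4"
        let ?Yi = "Y i `` {v}" and ?Yj = "Y j `` {v}"
        note bR' = bR lt(1)[OF b2(1) ij(1)] lt(1)[OF b5(1) ij(2)]
        have fin: "finite (M v b)" "card (M v b) \<le> K" if "b \<in> {b1, b2, b3, b4, b5}" for b
          using that M[of b v] v WW[OF that] bR' by auto
        have Yi: "N b1 \<inter> N b2 = Y i" using D(5)[OF ij(1) b1 b2(1)] b2(2) by blast
        have Yj: "N b3 \<inter> N b5 = Y j" using D(5)[OF ij(2) b3 b5(1)] b5(2) by blast
        have Yj': "N b4 \<inter> N b5 = Y j" using D(5)[OF ij(2) b4(1) b5(1)] b5(3) by blast
        have e2: "M v b2 - ?U = M v b2 - ?Yi" "?Yi \<subseteq> M v b2"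
          using Yi b2(3) by (auto simp: Mv[OF v])
        have e5: "M v b5 - ?U = M v b5 - ?Yj" "?Yj \<subseteq> M v b5"
          using Yj Yj' b5(4) by (auto simp: Mv[OF v])
        have "card ?Yi \<le> K" "card ?Yj \<le> K"
          using card_mono[OF _ e2(2)] card_mono[OF _ e5(2)] fin[of b2] fin[of b5] by auto
        moreover have "v < q" using W[OF bR(1)] v by auto
        moreover have "{(v, c). v < q \<and> c \<le> K \<and> c = card (Y i `` {v})} =
          {(v, c). v < q \<and> c \<le> K \<and> c = card (Y j `` {v})}" using ij(4) by (simp add: \<gamma>_def)
        ultimately have cY: "card ?Yi = card ?Yj" by auto
        have "(v, card (M v b2)) \<in> \<Gamma> b2" using WW[of b2] v by (auto simp: \<Gamma>_def)
        then have "(v, card (M v b2)) \<in> \<Gamma> b5" using \<Gamma>[of b2] \<Gamma>[of b5] by simp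
        then have cM: "card (M v b2) = card (M v b5)" by (auto simp: \<Gamma>_def)
        have finY: "finite ?Yi" "finite ?Yj" using e2(2) e5(2) fin by (auto intro: finite_subset)
        have finU: "finite ?U" using fin by simp
        have "(\<Union>b\<in>{b1, b2, b3, b4}. M v b) = ?U \<union> (M v b2 - ?U)"
          "(\<Union>b\<in>{b1, b3, b4, b5}. M v b) = ?U \<union> (M v b5 - ?U)" by auto
        moreover have "card (?U \<union> (M v b2 - ?U)) = card ?U + card (M v b2 - ?U)"
          "card (?U \<union> (M v b5 - ?U)) = card ?U + card (M v b5 - ?U)"
          using finU fin by (intro card_Un_disjoint; auto)+
        ultimately show ?thesis
          unfolding e2(1) e5(1) using card_Diff_subset[OF finY(1) e2(2)] card_Diff_subset[OF finY(2) e5(2)] cY cM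
          by simp
      qed
      have ne: "b1 \<noteq> b3" "b1 \<noteq> b4" "b1 \<noteq> b5" "b2 \<noteq> b3" "b2 \<noteq> b4" "b2 \<noteq> b5"
        using lt(2)[OF b1 ij(1)] lt(2)[OF b2(1) ij(1)] lt(2)[OF b3 ij(2)] lt(2)[OF b4(1) ij(2)]
          lt(2)[OF b5(1) ij(2)] ij(3) by auto
      show ?thesis
      proof (rule exI[of _ b1], rule exI[of _ b2], rule exI[of _ b3], rule exI[of _ b4], rule exI[of _ b5],
          intro conjI)
        show "\<forall>b\<in>{b1, b2, b3, b4, b5}. W b = W b1" using WW by blast
        show "\<forall>v\<in>W b1. card (\<Union>b\<in>{b1, b2, b3, b4}. M v b) = card (\<Union>b\<in>{b1, b3, b4, b5}. M v b)"
          using main by blast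
        show "distinct [b1, b2, b3, b4, b5]" using ne b2 b4 b5 by auto
      qed (use lt b1 b2 b3 b4 b5 ij in auto)
    qed
  qed
qed

section \<open>The lower bound\<close>

text \<open>The constants are fixed backwards: \<open>balanced_configuration\<close> gives
  \<open>L\<close>, comparing listed elements gives \<open>M\<close>, and the distance thresholds
  give \<open>N\<close>. For given codes the threshold refinement \<open>\<iota>\<close> comes
  first, because the sets \<open>A v\<close> used in the offsets depend on it.\<close>

lemma indistinguishable_configuration:
  "\<exists>s L N. \<forall>\<phi> \<psi> :: nat \<Rightarrow> (nat \<Rightarrow> nat) \<Rightarrow> nat set. (\<forall>v x. finite (\<phi> v x) \<and> finite (\<psi> v x)) \<longrightarrow>
     (\<exists>x y b1 b2 b3 b4 b5. x \<in> box L N \<and> y \<in> box L N \<and> (\<forall>p<L. x p < y p) \<and>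
        {b1, b2, b3, b4, b5} \<subseteq> {..<L} \<and> distinct [b1, b2, b3, b4, b5] \<and>
        b2 div s = b1 div s \<and> b4 div s = b3 div s \<and> b5 div s = b3 div s \<and> b1 div s \<noteq> b3 div s \<and>
        (\<forall>v<q. card (sym_diff (\<phi> v x) (\<psi> v (override_on x y {b1, b2, b3, b4}))) = k \<longleftrightarrow>
               card (sym_diff (\<phi> v x) (\<psi> v (override_on x y {b1, b3, b4, b5}))) = k))"
proof -
  note One_nat_def [simp del]
  obtain R s where bal: "\<forall>(W :: nat \<Rightarrow> nat set) (M :: nat \<Rightarrow> nat \<Rightarrow> nat set).
     (\<forall>p<R * s. W p \<subseteq> {..<q} \<and> (\<forall>v\<in>W p. finite (M v p) \<and> card (M v p) \<le> 10 * k)) \<longrightarrow>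
     (\<exists>b1 b2 b3 b4 b5. {b1, b2, b3, b4, b5} \<subseteq> {..<R * s} \<and> distinct [b1, b2, b3, b4, b5] \<and>
        b2 div s = b1 div s \<and> b4 div s = b3 div s \<and> b5 div s = b3 div s \<and> b1 div s \<noteq> b3 div s \<and>
        (\<forall>b\<in>{b1, b2, b3, b4, b5}. W b = W b1) \<and>
        (\<forall>v\<in>W b1. card (\<Union>b\<in>{b1, b2, b3, b4}. M v b) = card (\<Union>b\<in>{b1, b3, b4, b5}. M v b)))"
    using balanced_configuration[of q "10 * k"] by (elim exE)
  define L where "L = R * s"
  define Q where "Q = 9 * k + 2 * k * L + 1"
  define \<Theta> where "\<Theta> = {..<q} \<times> {..<4::nat} \<times> {..<Q} \<times> {..<Q}"
  have "finite \<Theta>" by (simp add: \<Theta>_def)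
  from pattern_ramsey[OF this, of L 3] obtain M where M: "\<forall>P. \<exists>\<iota>. (\<forall>p<L. strict_mono_on {..<3} (\<iota> p)) \<and>
      (\<forall>p<L. \<forall>j<3. \<iota> p j < M) \<and>
      (\<forall>\<theta>\<in>\<Theta>. pattern_invariant L 3 (\<lambda>x y. P \<theta> (reparam L \<iota> x) (reparam L \<iota> y)))" ..
  define \<Xi> where "\<Xi> = {..<q} \<times> {..<3::nat}"
  have "finite \<Xi>" by (simp add: \<Xi>_def)
  from pattern_ramsey[OF this, of L "M + 3"] obtain N where N: "\<forall>P. \<exists>\<iota>. (\<forall>p<L. strict_mono_on {..<M + 3} (\<iota> p)) \<and>
      (\<forall>p<L. \<forall>j<M + 3. \<iota> p j < N) \<and>
      (\<forall>\<theta>\<in>\<Xi>. pattern_invariant L (M + 3) (\<lambda>x y. P \<theta> (reparam L \<iota> x) (reparam L \<iota> y)))" ..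
  show ?thesis
  proof (rule exI[of _ s], rule exI[of _ L], rule exI[of _ N], intro allI impI)
    fix \<phi>0 \<psi>0 :: "nat \<Rightarrow> (nat \<Rightarrow> nat) \<Rightarrow> nat set"
    assume fin0: "\<forall>v x. finite (\<phi>0 v x) \<and> finite (\<psi>0 v x)"
    obtain \<iota> where \<iota>: "\<forall>p<L. strict_mono_on {..<M + 3} (\<iota> p)" "\<forall>p<L. \<forall>j<M + 3. \<iota> p j < N"
      and inv0: "\<forall>\<theta>\<in>\<Xi>. pattern_invariant L (M + 3)
        (\<lambda>x y. case \<theta> of (v, i) \<Rightarrow> [card (sym_diff (\<phi>0 v (reparam L \<iota> x)) (\<phi>0 v (reparam L \<iota> y))) \<le> 2 * k,
          card (sym_diff (\<phi>0 v (reparam L \<iota> x)) (\<psi>0 v (reparam L \<iota> y))) \<le> k,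
          card (sym_diff (\<phi>0 v (reparam L \<iota> x)) (\<psi>0 v (reparam L \<iota> y))) \<le> 9 * k] ! i)"
      using N[THEN spec, of "\<lambda>\<theta> x y. case \<theta> of (v, i) \<Rightarrow> [card (sym_diff (\<phi>0 v x) (\<phi>0 v y)) \<le> 2 * k,
          card (sym_diff (\<phi>0 v x) (\<psi>0 v y)) \<le> k, card (sym_diff (\<phi>0 v x) (\<psi>0 v y)) \<le> 9 * k] ! i"]
      by (elim exE conjE)
    define \<phi> where "\<phi> v x = \<phi>0 v (reparam L \<iota> x)" for v x
    define \<psi> where "\<psi> v x = \<psi>0 v (reparam L \<iota> x)" for v x
    have fin: "finite (\<phi> v x)" "finite (\<psi> v x)" for v x using fin0 by (simp_all add: \<phi>_def \<psi>_def)
    have inv: "pattern_invariant L (M + 3) (\<lambda>x y. card (sym_diff (\<phi> v x) (\<phi> v y)) \<le> 2 * k)"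
      "pattern_invariant L (M + 3) (\<lambda>x y. card (sym_diff (\<phi> v x) (\<psi> v y)) \<le> k)"
      "pattern_invariant L (M + 3) (\<lambda>x y. card (sym_diff (\<phi> v x) (\<psi> v y)) \<le> 9 * k)" if v: "v < q" for v
      using inv0[THEN bspec, of "(v, 0)"] inv0[THEN bspec, of "(v, 1)"] inv0[THEN bspec, of "(v, 2)"] v
      by (simp_all add: \<Xi>_def \<phi>_def \<psi>_def)
    \<comment> \<open>Positions at which query \<open>v\<close> is well behaved. A large base
      distance makes \<open>A v\<close> empty, so \<open>far_apart\<close> covers both reasons for
      \<open>b1 \<notin> A v\<close>.\<close>
    define A where "A v = {p. p < L \<and> card (sym_diff (\<phi> v (diag L 0)) (\<psi> v (diag L 0))) \<le> 9 * k \<and>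
      card (sym_diff (\<phi> v (diag L 0)) (\<phi> v (override_on (diag L 0) (diag L 1) {p}))) \<le> 2 * k}" for v
    obtain \<kappa> where \<kappa>: "\<forall>p<L. strict_mono_on {..<3} (\<kappa> p)" "\<forall>p<L. \<forall>j<3. \<kappa> p j < M"
      and cmp: "\<forall>\<theta>\<in>\<Theta>. pattern_invariant L 3 (\<lambda>x y. case \<theta> of (v, i, a, b) \<Rightarrow>
        comparison i a b (offset L (A v) (\<phi> v) (\<phi> v)) (offset L (A v) (\<phi> v) (\<psi> v)) (reparam L \<kappa> x) (reparam L \<kappa> y))"
      using M[THEN spec, of "\<lambda>\<theta> x y. case \<theta> of (v, i, a, b) \<Rightarrow>
        comparison i a b (offset L (A v) (\<phi> v) (\<phi> v)) (offset L (A v) (\<phi> v) (\<psi> v)) x y"]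
      by (elim exE conjE)
    define X where "X = reparam L \<kappa> (diag L 0)"
    define Y where "Y = reparam L \<kappa> (diag L 1)"
    have XYM: "X \<in> box L M" "Y \<in> box L M"
      unfolding X_def Y_def by (rule reparam_box[of _ L 3]; use \<kappa> in simp)+
    then have XY: "X \<in> box L (M + 3)" "Y \<in> box L (M + 3)" by (simp_all add: box_mono)
    have XltY: "X p < Y p" if "p < L" for p
      unfolding X_def Y_def using that \<kappa> by (intro reparam_less[of _ L 3]) simp_all
    have "\<exists>m r N. (\<forall>p\<in>A v. finite (N p) \<and> card (N p) \<le> 10 * k) \<and>
      (\<forall>D\<subseteq>A v. card (sym_diff (\<phi> v X) (\<psi> v (override_on X Y D))) + 2 * m = r + 2 * card (\<Union>p\<in>D. N p :: nat set))"
      if v: "v < q" for v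
    proof (cases "A v = {}")
      \<comment> \<open>Only \<open>D = {}\<close> remains, where the distance is a
        constant.\<close>
      case True
      then show ?thesis
        by (intro exI[of _ 0] exI[of _ "card (sym_diff (\<phi> v X) (\<psi> v X))"]) auto
    next
      case False
      show ?thesis unfolding X_def Y_def
      proof (rule distance_coverage)
        show "pattern_invariant L 3 (\<lambda>x y. comparison i a b (offset L (A v) (\<phi> v) (\<phi> v)) (offset L (A v) (\<phi> v) (\<psi> v))
            (reparam L \<kappa> x) (reparam L \<kappa> y))"
          if "i < 4" "a < 9 * k + 2 * k * L + 1" "b < 9 * k + 2 * k * L + 1" for i a b
          using cmp[THEN bspec, of "(v, i, a, b)"] that v by (simp add: \<Theta>_def Q_def)
      qed (use fin inv[OF v] \<kappa> False in \<open>auto simp: A_def\<close>)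
    qed
    then obtain m r N' where N': "\<And>v p. v < q \<Longrightarrow> p \<in> A v \<Longrightarrow> finite (N' v p) \<and> card (N' v p) \<le> 10 * k"
      and eq: "\<And>v D. v < q \<Longrightarrow> D \<subseteq> A v \<Longrightarrow>
        card (sym_diff (\<phi> v X) (\<psi> v (override_on X Y D))) + 2 * m v = r v + 2 * card (\<Union>p\<in>D. N' v p :: nat set)"
      by metis
    define W where "W p = {v. v < q \<and> p \<in> A v}" for p
    have "\<forall>p<R * s. W p \<subseteq> {..<q} \<and> (\<forall>v\<in>W p. finite (N' v p) \<and> card (N' v p) \<le> 10 * k)"
      using N' by (auto simp: W_def)
    from bal[THEN spec, THEN spec, THEN mp, OF this]
    obtain b1 b2 b3 b4 b5 where b: "{b1, b2, b3, b4, b5} \<subseteq> {..<L}" "distinct [b1, b2, b3, b4, b5]"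
        "b2 div s = b1 div s" "b4 div s = b3 div s" "b5 div s = b3 div s" "b1 div s \<noteq> b3 div s"
      and WW: "\<forall>b\<in>{b1, b2, b3, b4, b5}. W b = W b1"
      and un: "\<forall>v\<in>W b1. card (\<Union>b\<in>{b1, b2, b3, b4}. N' v b) = card (\<Union>b\<in>{b1, b3, b4, b5}. N' v b)"
      unfolding L_def by (elim exE conjE)
    \<comment> \<open>The five positions lie in the same sets \<open>A v\<close>. Either the
      coverage formula equates the two distances, or \<open>b1\<close>, which belongs to both
      changed sets, forces both answers to be negative.\<close>
    have same: "card (sym_diff (\<phi> v X) (\<psi> v (override_on X Y {b1, b2, b3, b4}))) = k \<longleftrightarrow>
      card (sym_diff (\<phi> v X) (\<psi> v (override_on X Y {b1, b3, b4, b5}))) = k" if v: "v < q" for v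
    proof (cases "v \<in> W b1")
      case True
      have *: "b \<in> A v" if "b \<in> {b1, b2, b3, b4, b5}" for b
        using WW[THEN bspec, OF that] True by (auto simp: W_def)
      have D: "{b1, b2, b3, b4} \<subseteq> A v" "{b1, b3, b4, b5} \<subseteq> A v" using * by blast+
      show ?thesis
        using eq[OF v D(1)] eq[OF v D(2)] un[THEN bspec, OF True] by linarith
    next
      case False
      then have "b1 \<notin> A v" using v by (simp add: W_def)
      moreover have "b1 < L" using b(1) by simp
      ultimately have bad: "\<not> card (sym_diff (\<phi> v (diag L 0)) (\<psi> v (diag L 0))) \<le> 9 * k \<or>
        (\<exists>p\<in>D. \<not> card (sym_diff (\<phi> v (diag L 0)) (\<phi> v (override_on (diag L 0) (diag L 1) {p}))) \<le> 2 * k)"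
        if "b1 \<in> D" for D using that by (auto simp: A_def)
      have far: "k < card (sym_diff (\<phi> v X) (\<psi> v (override_on X Y D)))"
        if "b1 \<in> D" "D \<subseteq> {..<L}" "card D \<le> 4" for D
        using fin _ inv[OF v] that(2,3) bad[OF that(1)] XY XltY by (rule far_apart) simp
      have "k < card (sym_diff (\<phi> v X) (\<psi> v (override_on X Y {b1, b2, b3, b4})))"
        "k < card (sym_diff (\<phi> v X) (\<psi> v (override_on X Y {b1, b3, b4, b5})))"
        using b(1,2) by (auto intro!: far)
      then show ?thesis by simp
    qed
    show "\<exists>x y b1 b2 b3 b4 b5. x \<in> box L N \<and> y \<in> box L N \<and> (\<forall>p<L. x p < y p) \<and>
        {b1, b2, b3, b4, b5} \<subseteq> {..<L} \<and> distinct [b1, b2, b3, b4, b5] \<and>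
        b2 div s = b1 div s \<and> b4 div s = b3 div s \<and> b5 div s = b3 div s \<and> b1 div s \<noteq> b3 div s \<and>
        (\<forall>v<q. card (sym_diff (\<phi>0 v x) (\<psi>0 v (override_on x y {b1, b2, b3, b4}))) = k \<longleftrightarrow>
               card (sym_diff (\<phi>0 v x) (\<psi>0 v (override_on x y {b1, b3, b4, b5}))) = k)"
    proof (rule exI[of _ "reparam L \<iota> X"], rule exI[of _ "reparam L \<iota> Y"], rule exI[of _ b1], rule exI[of _ b2],
        rule exI[of _ b3], rule exI[of _ b4], rule exI[of _ b5], intro conjI)
      show "reparam L \<iota> X \<in> box L N" "reparam L \<iota> Y \<in> box L N"
        using XY \<iota>(2) by (auto intro: reparam_box[of _ L "M + 3"])
      show "\<forall>p<L. reparam L \<iota> X p < reparam L \<iota> Y p"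
        using XY XltY \<iota>(1) by (auto intro: reparam_less[of _ L "M + 3"])
      show "\<forall>v<q. card (sym_diff (\<phi>0 v (reparam L \<iota> X)) (\<psi>0 v (override_on (reparam L \<iota> X) (reparam L \<iota> Y) {b1, b2, b3, b4}))) = k \<longleftrightarrow>
         card (sym_diff (\<phi>0 v (reparam L \<iota> X)) (\<psi>0 v (override_on (reparam L \<iota> X) (reparam L \<iota> Y) {b1, b3, b4, b5}))) = k"
        using same unfolding \<phi>_def \<psi>_def reparam_override_on by blast
    qed (fact b)+
  qed
qed

section \<open>Protocol trees of bounded cost and their queries\<close>

lemma card_queries: "finite (queries T) \<and> Suc (card (queries T)) \<le> 2 ^ cost T"
proof (induction T)
  case (Leaf a)
  show ?case by simp
next
  case (Node M T0 T1)
  have "card (queries (Node M T0 T1)) \<le> Suc (card (queries T0 \<union> queries T1))"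
    using Node by (simp add: card_insert_if)
  moreover have "card (queries T0 \<union> queries T1) \<le> card (queries T0) + card (queries T1)"
    by (rule card_Un_le)
  moreover have "(2::nat) ^ cost T0 \<le> 2 ^ max (cost T0) (cost T1)" "(2::nat) ^ cost T1 \<le> 2 ^ max (cost T0) (cost T1)"
    by (auto intro: power_increasing)
  ultimately have "Suc (card (queries (Node M T0 T1))) \<le> 2 * 2 ^ max (cost T0) (cost T1)"
    using Node by linarith
  then show ?case using Node by simp
qed

lemma run_cong: "(\<And>M. M \<in> queries T \<Longrightarrow> M x y = M x' y') \<Longrightarrow> run T x y = run T x' y'"
  by (induction T) auto

text \<open>The set of costs is nonempty, since its infimum would otherwise be infinite, and a
  nonempty set of \<open>enat\<close> values contains its infimum.\<close>

lemma oracle_complexity_leD: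
  assumes "oracle_complexity \<Q> P \<le> enat c"
  shows "\<exists>T. oracle_protocol \<Q> P T \<and> computes T P \<and> cost T \<le> c"
proof -
  let ?S = "{enat (cost T) | T. oracle_protocol \<Q> P T \<and> computes T P}"
  have ne: "?S \<noteq> {}"
  proof
    assume "?S = {}"
    then have "oracle_complexity \<Q> P = \<infinity>" by (simp only: oracle_complexity_def) (simp add: Inf_enat_def)
    then show False using assms by simp
  qed
  then have "Inf ?S \<in> ?S" unfolding Inf_enat_def by (metis (mono_tags, lifting) LeastI ex_in_conv)
  then show ?thesis using assms unfolding oracle_complexity_def[symmetric] by auto
qed

section \<open>Strings as sets of ones, and points encoded as Boolean matrices\<close>

definition ones :: "bool list \<Rightarrow> nat set" where
  "ones u = {i. i < length u \<and> u ! i}"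

lemma finite_ones [simp]: "finite (ones u)"
  by (simp add: ones_def)

lemma hdist_eq_card_sym_diff: "length u = length w \<Longrightarrow> hdist u w = card (sym_diff (ones u) (ones w))"
  unfolding hdist_def ones_def by (rule arg_cong[where f = card]) auto

lemma hdist_eq_0_iff: "length u = length w \<Longrightarrow> hdist u w = 0 \<longleftrightarrow> u = w"
  by (auto simp: hdist_def list_eq_iff_nth_eq)

text \<open>Position \<open>p\<close> occupies row \<open>p div s\<close> and its own block of \<open>N\<close> columns, in which the value \<open>x p\<close>
  is marked by a single one. Changing one value changes the row distance by \<open>2\<close>.\<close>

definition one_hot :: "nat \<Rightarrow> nat \<Rightarrow> nat \<Rightarrow> (nat \<Rightarrow> nat) \<Rightarrow> bool list list" where
  "one_hot s L N x = map (\<lambda>i. map (\<lambda>j. j div N div s = i \<and> x (j div N) = j mod N) [0..<L * N]) [0..<L * N]"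

lemma one_hot_square: "one_hot s L N x \<in> square_matrices (L * N)"
  by (auto simp: one_hot_def square_matrices_def bitstrings_def)

lemma hdist_one_hot:
  assumes x: "x \<in> box L N" and y: "y \<in> box L N" and ne: "\<And>p. p < L \<Longrightarrow> x p < y p"
    and D: "D \<subseteq> {..<L}" and i: "i < L * N"
  shows "hdist (one_hot s L N x ! i) (one_hot s L N (override_on x y D) ! i) = 2 * card {p \<in> D. p div s = i}"
proof -
  let ?D = "{p \<in> D. p div s = i}"
  let ?y = "override_on x y D"
  have finD: "finite ?D" using D finite_subset[of D "{..<L}"] by simp
  have lt: "p * N + c < L * N" if "p < L" "c < N" for p c
  proof -
    have "p * N + c < Suc p * N" using that by simp
    also have "\<dots> \<le> L * N" using that by (intro mult_le_mono1) simp
    finally show ?thesis .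
  qed
  have xN: "x p < N" "y p < N" if "p \<in> D" for p using x y that D by (auto intro: box_less)
  \<comment> \<open>For each changed position of row \<open>i\<close>, one mark is removed and one
    is set, in different columns of its own block.\<close>
  have "{j. j < L * N \<and> one_hot s L N x ! i ! j \<noteq> one_hot s L N ?y ! i ! j} =
    (\<lambda>p. p * N + x p) ` ?D \<union> (\<lambda>p. p * N + y p) ` ?D" (is "?S = ?U")
  proof
    show "?S \<subseteq> ?U"
    proof
      fix j assume "j \<in> ?S"
      then have j: "j < L * N" "(j div N div s = i \<and> x (j div N) = j mod N) \<noteq> (j div N div s = i \<and> ?y (j div N) = j mod N)"
        using i by (auto simp: one_hot_def)
      have "j div N \<in> ?D" using j(2) by (cases "j div N \<in> D") auto
      moreover have "j = (j div N) * N + j mod N" by simp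
      moreover have "j mod N = x (j div N) \<or> j mod N = y (j div N)" using j(2) by (cases "j div N \<in> D") auto
      ultimately show "j \<in> ?U" by (metis (no_types, lifting) UnCI imageI)
    qed
    show "?U \<subseteq> ?S"
    proof
      fix j assume "j \<in> ?U"
      then obtain p where p: "p \<in> ?D" "j = p * N + x p \<or> j = p * N + y p" by blast
      then have pD: "p \<in> D" "p < L" using D by auto
      have j: "j < L * N" "j div N = p" "j mod N = x p \<or> j mod N = y p"
        using p(2) lt xN[OF pD(1)] pD(2) by auto
      have "one_hot s L N z ! i ! j \<longleftrightarrow> z p = j mod N" for z
        using i j(1,2) p(1) by (simp add: one_hot_def)
      moreover have "x p \<noteq> y p" "?y p = y p" using ne[OF pD(2)] pD(1) by simp_all
      ultimately have "one_hot s L N x ! i ! j \<noteq> one_hot s L N ?y ! i ! j" using j(3) by metis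
      then show "j \<in> ?S" using j(1) by blast
    qed
  qed
  moreover have "card ?U = card ?D + card ?D"
  proof -
    have inj: "inj_on (\<lambda>p. p * N + z p) ?D" if "\<And>p. p \<in> D \<Longrightarrow> z p < N" for z
    proof (rule inj_on_inverseI[of _ "\<lambda>j. j div N"])
      fix p assume "p \<in> ?D"
      then have "z p < N" using that by simp
      then show "(p * N + z p) div N = p" by simp
    qed
    have "(\<lambda>p. p * N + x p) ` ?D \<inter> (\<lambda>p. p * N + y p) ` ?D = {}"
    proof (rule ccontr)
      assume "\<not> ?thesis"
      then obtain p p' where p: "p \<in> D" "p' \<in> D" "p * N + x p = p' * N + y p'" by auto
      then have "(p * N + x p) div N = (p' * N + y p') div N" by simp
      then have "p = p'" using xN(1)[OF p(1)] xN(2)[OF p(2)] by simp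
      then show False using p ne[of p] D by auto
    qed
    then show ?thesis using finD inj[of x] inj[of y] xN by (simp add: card_Un_disjoint card_image)
  qed
  ultimately show ?thesis using i by (simp add: hdist_def one_hot_def)
qed

text \<open>Counting changed positions per row gives distances \<open>4\<close>, \<open>4\<close> in
  the first case and \<open>2\<close>, \<open>6\<close> in the second. The second answer is negative
  because no row has distance \<open>4\<close>.\<close>

lemma HD44_one_hot:
  assumes x: "x \<in> box L N" and y: "y \<in> box L N" and ne: "\<And>p. p < L \<Longrightarrow> x p < y p"
    and b: "{b1, b2, b3, b4, b5} \<subseteq> {..<L}" "distinct [b1, b2, b3, b4, b5]"
      "b2 div s = b1 div s" "b4 div s = b3 div s" "b5 div s = b3 div s" "b1 div s \<noteq> b3 div s"
  shows "entry (HD44 (L * N)) (one_hot s L N x) (one_hot s L N (override_on x y {b1, b2, b3, b4}))"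
    and "\<not> entry (HD44 (L * N)) (one_hot s L N x) (one_hot s L N (override_on x y {b1, b3, b4, b5}))"
proof -
  let ?n = "L * N"
  let ?X = "one_hot s L N x" and ?Y = "\<lambda>D. one_hot s L N (override_on x y D)"
  have row: "b div s < ?n" if "b < L" for b
  proof -
    \<comment> \<open>Since \<open>N\<close> is positive, row indices below \<open>L\<close> fit
      into the \<open>L * N\<close> rows.\<close>
    have "0 < N" using ne[OF that] box_less[OF y that] by simp
    have "b div s \<le> b" by simp
    also have "b < L" by fact
    also have "L \<le> ?n" using \<open>0 < N\<close> by simp
    finally show ?thesis .
  qed
  have dist: "hdist (?X ! i) (?Y D ! i) = 2 * card {p \<in> D. p div s = i}" if "D \<subseteq> {..<L}" "i < ?n" for D i
    using x y ne that by (rule hdist_one_hot)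
  have len: "length (?X ! i) = length (?Y D ! i)" if "i < ?n" for i D using that by (simp add: one_hot_def)
  show "entry (HD44 ?n) ?X (?Y {b1, b2, b3, b4})"
  proof -
    let ?D = "{b1, b2, b3, b4}"
    have D: "?D \<subseteq> {..<L}" using b(1) by auto
    have "{p \<in> ?D. p div s = b1 div s} = {b1, b2}" "{p \<in> ?D. p div s = b3 div s} = {b3, b4}"
      using b(3-6) by auto
    then have "hdist (?X ! (b1 div s)) (?Y ?D ! (b1 div s)) = 4" "hdist (?X ! (b3 div s)) (?Y ?D ! (b3 div s)) = 4"
      using dist[OF D row[of b1]] dist[OF D row[of b3]] b(1,2) by simp_all
    moreover have "?X ! l = ?Y ?D ! l" if l: "l < ?n" "l \<notin> {b1 div s, b3 div s}" for l
    proof -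
      have "{p \<in> ?D. p div s = l} = {}" using l(2) b(3-6) by auto
      then have "hdist (?X ! l) (?Y ?D ! l) = 0" using dist[OF D l(1)] by (simp only: card.empty)
      then show ?thesis using hdist_eq_0_iff[OF len[OF l(1), of ?D]] by blast
    qed
    moreover have "b1 div s < ?n" "b3 div s < ?n" using row b(1) by simp_all
    ultimately show ?thesis unfolding HD44_def using b(6) by auto
  qed
  show "\<not> entry (HD44 ?n) ?X (?Y {b1, b3, b4, b5})"
  proof
    let ?D = "{b1, b3, b4, b5}"
    have D: "?D \<subseteq> {..<L}" using b(1) by auto
    assume "entry (HD44 ?n) ?X (?Y ?D)"
    then obtain i where i: "i < ?n" "hdist (?X ! i) (?Y ?D ! i) = 4" by (auto simp: HD44_def)
    then have c: "card {p \<in> ?D. p div s = i} = 2" using dist[OF D i(1)] by simp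
    consider "i = b1 div s" | "i = b3 div s" | "i \<noteq> b1 div s" "i \<noteq> b3 div s" by blast
    then show False
    proof cases
      case 1
      then have "{p \<in> ?D. p div s = i} = {b1}" using b(3-6) by auto
      then show False using c by simp
    next
      case 2
      then have "{p \<in> ?D. p div s = i} = {b3, b4, b5}" using b(3-6) by auto
      then show False using c b(2) by simp
    next
      case 3
      then have "{p \<in> ?D. p div s = i} = {}" using b(3-6) by auto
      then have "card ({} :: nat set) = 2" using c by (simp only:)
      then show False by simp
    qed
  qed
qed

text \<open>Each query may use its own string length \<open>t\<close>, but the two strings it
  compares have equal length, so only their sets of ones matter. Numbering the queries below
  \<open>q\<close> yields the indexed families of the combinatorial part.\<close>

lemma HD_queries_representation:
  assumes "queries T \<subseteq> QS (HD_family k) X Y" "Suc (card (queries T)) \<le> q"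
  shows "\<exists>\<phi> \<psi>. \<forall>M\<in>queries T. \<exists>v<q. \<forall>x\<in>X. \<forall>y\<in>Y. M x y \<longleftrightarrow> card (sym_diff (ones (\<phi> v x)) (ones (\<psi> v y))) = k"
proof -
  have "\<exists>\<phi> \<psi>. \<forall>x\<in>X. \<forall>y\<in>Y. M x y \<longleftrightarrow> card (sym_diff (ones (\<phi> x)) (ones (\<psi> y))) = k" if "M \<in> queries T" for M
  proof -
    have "M \<in> QS (HD_family k) X Y" using that assms(1) by (rule subsetD[rotated])
    then obtain t \<phi> \<psi> where *: "\<phi> ` X \<subseteq> bitstrings t" "\<psi> ` Y \<subseteq> bitstrings t"
      "\<forall>x\<in>X. \<forall>y\<in>Y. M x y \<longleftrightarrow> hdist (\<phi> x) (\<psi> y) = k"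
      by (auto simp: QS_def HD_family_def HD_def)
    have "length (\<phi> x) = length (\<psi> y)" if "x \<in> X" "y \<in> Y" for x y
    proof -
      have "\<phi> x \<in> bitstrings t" "\<psi> y \<in> bitstrings t" using that *(1,2) by blast+
      then show ?thesis by (simp add: bitstrings_def)
    qed
    then show ?thesis using *(3) by (auto simp: hdist_eq_card_sym_diff)
  qed
  then obtain \<phi> \<psi> where \<phi>\<psi>: "\<And>M x y. M \<in> queries T \<Longrightarrow> x \<in> X \<Longrightarrow> y \<in> Y \<Longrightarrow>
      M x y \<longleftrightarrow> card (sym_diff (ones (\<phi> M x)) (ones (\<psi> M y))) = k"
    by metis
  obtain f where f: "bij_betw f {0..<card (queries T)} (queries T)"
    using ex_bij_betw_nat_finite card_queries by blast
  have "\<exists>v<q. \<forall>x\<in>X. \<forall>y\<in>Y. M x y \<longleftrightarrow> card (sym_diff (ones (\<phi> (f v) x)) (ones (\<psi> (f v) y))) = k"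
    if M: "M \<in> queries T" for M
  proof -
    have "M \<in> f ` {0..<card (queries T)}" using M f by (simp add: bij_betw_def)
    then obtain v where "v < card (queries T)" "f v = M" by auto
    then show ?thesis using assms(2) \<phi>\<psi>[OF M] by (intro exI[of _ v]) auto
  qed
  then show ?thesis
    by (intro exI[of _ "\<lambda>v. \<phi> (f v)"] exI[of _ "\<lambda>v. \<psi> (f v)"]) blast
qed

theorem theorem1p6:
  fixes k :: nat
  shows "\<not> reduces_to HD44_family (HD_family k)"
proof
  assume "reduces_to HD44_family (HD_family k)"
  then obtain c where c: "\<And>n. oracle_complexity (HD_family k) (HD44 n) \<le> enat c"
    by (auto simp: reduces_to_def HD44_family_def)
  \<comment> \<open>\<open>2 ^ c\<close> exceeds the number of queries of any protocol of cost at
    most \<open>c\<close>, so the matrix size \<open>L * N\<close> is fixed before the protocol is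
    chosen.\<close>
  obtain s L N where conf: "\<forall>\<phi> \<psi> :: nat \<Rightarrow> (nat \<Rightarrow> nat) \<Rightarrow> nat set. (\<forall>v x. finite (\<phi> v x) \<and> finite (\<psi> v x)) \<longrightarrow>
     (\<exists>x y b1 b2 b3 b4 b5. x \<in> box L N \<and> y \<in> box L N \<and> (\<forall>p<L. x p < y p) \<and>
        {b1, b2, b3, b4, b5} \<subseteq> {..<L} \<and> distinct [b1, b2, b3, b4, b5] \<and>
        b2 div s = b1 div s \<and> b4 div s = b3 div s \<and> b5 div s = b3 div s \<and> b1 div s \<noteq> b3 div s \<and>
        (\<forall>v<(2::nat) ^ c. card (sym_diff (\<phi> v x) (\<psi> v (override_on x y {b1, b2, b3, b4}))) = k \<longleftrightarrow>
               card (sym_diff (\<phi> v x) (\<psi> v (override_on x y {b1, b3, b4, b5}))) = k))"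
    using indistinguishable_configuration[of "2 ^ c" k] by (elim exE)
  let ?n = "L * N" and ?enc = "one_hot s L N"
  obtain T where T: "oracle_protocol (HD_family k) (HD44 ?n) T" "computes T (HD44 ?n)" "cost T \<le> c"
    using oracle_complexity_leD[OF c] by blast
  have "Suc (card (queries T)) \<le> 2 ^ cost T" using card_queries by blast
  also have "\<dots> \<le> 2 ^ c" using T(3) by (intro power_increasing) simp_all
  finally have q: "Suc (card (queries T)) \<le> 2 ^ c" .
  have "queries T \<subseteq> QS (HD_family k) (square_matrices ?n) (square_matrices ?n)"
    using T(1) by (simp add: oracle_protocol_def HD44_def)
  from HD_queries_representation[OF this q] obtain \<phi> \<psi> where
    rep: "\<forall>M\<in>queries T. \<exists>v<(2::nat) ^ c. \<forall>x\<in>square_matrices ?n. \<forall>y\<in>square_matrices ?n.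
      M x y \<longleftrightarrow> card (sym_diff (ones (\<phi> v x)) (ones (\<psi> v y))) = k"
    by (elim exE)
  have "\<forall>v x. finite (ones (\<phi> v (?enc x))) \<and> finite (ones (\<psi> v (?enc x)))" by simp
  from conf[THEN spec, THEN spec, THEN mp, OF this] obtain x y b1 b2 b3 b4 b5 where
    xy: "x \<in> box L N" "y \<in> box L N" "\<forall>p<L. x p < y p" and
    b: "{b1, b2, b3, b4, b5} \<subseteq> {..<L}" "distinct [b1, b2, b3, b4, b5]"
      "b2 div s = b1 div s" "b4 div s = b3 div s" "b5 div s = b3 div s" "b1 div s \<noteq> b3 div s" and
    same: "\<forall>v<(2::nat) ^ c. card (sym_diff (ones (\<phi> v (?enc x))) (ones (\<psi> v (?enc (override_on x y {b1, b2, b3, b4}))))) = k \<longleftrightarrow>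
      card (sym_diff (ones (\<phi> v (?enc x))) (ones (\<psi> v (?enc (override_on x y {b1, b3, b4, b5}))))) = k"
    by (elim exE conjE)
  have "run T (?enc x) (?enc (override_on x y {b1, b2, b3, b4})) = run T (?enc x) (?enc (override_on x y {b1, b3, b4, b5}))"
  proof (rule run_cong)
    fix M assume "M \<in> queries T"
    then show "M (?enc x) (?enc (override_on x y {b1, b2, b3, b4})) = M (?enc x) (?enc (override_on x y {b1, b3, b4, b5}))"
      using rep same one_hot_square by metis
  qed
  moreover have "run T (?enc x) (?enc z) = entry (HD44 ?n) (?enc x) (?enc z)" for z
    using T(2) one_hot_square by (simp add: computes_def HD44_def)
  ultimately show False
    using HD44_one_hot[OF xy(1,2) xy(3)[rule_format] b] by simp
qed

end
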